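(* Let $G$ be a finite group, let $n$ be a positive integer, and let $\mathcal{F}$ be a generating family (i.e. $\langle\bigcup_{F\in\mathcal{F}}F\rangle=G$) of distinct subgroups of $G$, closed under conjugation (i.e. $F^g=g^{-1}Fg\in\mathcal{F}$ for all $F\in\mathcal{F}$ and $g\in G$), such that for every $F\in\mathcal{F}$ the exponent of $F$ divides $n$ and $F$ is $C_n$-cellular. Let $\varphi:S\to G$ be the canonical surjective homomorphism from the active sum $S$ of $\mathcal{F}$ to $G$. If $\pi(H_2(G))\subseteq\pi(n)$ and $\varphi$ is a $C_n$-injection, then $\varphi$ is an isomorphism from $S$ onto $G$.
   Context: $C_n$ denotes a (multiplicative) cyclic group of order $n$. For a positive integer $n$, $\pi(n)$ is the set of primes dividing $n$; for a finite group $K$, $\pi(K)=\pi(|K|)$. $H_2(K)=H_2(K,\mathbb{Z})$ denotes the Schur multiplier of a group $K$. Active sum: for a family $\mathcal{F}$ of distinct subgroups of a group $G$ closed under conjugation, the active sum $S$ of $\mathcal{F}$ is the quotient of the free product $\amalg_{F\in\mathcal{F}}F$ of the groups in $\mathcal{F}$ by the normal subgroup generated by all elements of the form $h^{-1}\cdot g\cdot h\cdot (g^h)^{-1}$ with $h\in F_1$, $g\in F_2$, $F_1,F_2\in\mathcal{F}$. Here the products are taken in the free product ($h$ in the factor $F_1$, $g$ in the factor $F_2$), while $g^h=h^{-1}gh$ is the conjugate computed in $G$, regarded as an element of the factor $F_2^h=h^{-1}F_2h\in\mathcal{F}$. The canonical homomorphism $\varphi:S\to G$ is the one induced by the inclusions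 $F\hookrightarrow G$, $F\in\mathcal{F}$; it is surjective when $\mathcal{F}$ is generating. Cellularity: for a group $A$ and a group homomorphism $f:X\to Y$, let $\mathrm{Hom}(A,f):\mathrm{Hom}(A,X)\to\mathrm{Hom}(A,Y)$ be the map $t\mapsto f\circ t$. The homomorphism $f$ is an $A$-equivalence if $\mathrm{Hom}(A,f)$ is a bijection, and an $A$-injection if $\mathrm{Hom}(A,f)$ is injective. A group $H$ is $A$-cellular if every $A$-equivalence $f:X\to Y$ (for arbitrary groups $X,Y$) is also an $H$-equivalence. *)

theory Defs
  imports
    "HOL-Algebra.Free_Abelian_Groups"
    "HOL-Algebra.Weak_Morphisms"
    "HOL-Algebra.Multiplicative_Group"
    "HOL-Computational_Algebra.Primes"
    "HOL-Library.Infinite_Typeclass"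
begin

section \<open>Free products\<close>

definition fp_words :: "'i set \<Rightarrow> ('i \<Rightarrow> ('a, 'b) monoid_scheme) \<Rightarrow> ('i \<times> 'a) list set"
  where "fp_words I H = lists (SIGMA i:I. carrier (H i))"

inductive fp_eq :: "'i set \<Rightarrow> ('i \<Rightarrow> ('a, 'b) monoid_scheme) \<Rightarrow> ('i \<times> 'a) list \<Rightarrow> ('i \<times> 'a) list \<Rightarrow> bool"
  for I H where
  refl: "w \<in> fp_words I H \<Longrightarrow> fp_eq I H w w"
| sym: "fp_eq I H v w \<Longrightarrow> fp_eq I H w v"
| trans: "fp_eq I H u v \<Longrightarrow> fp_eq I H v w \<Longrightarrow> fp_eq I H u w"
| one: "\<lbrakk>u \<in> fp_words I H; v \<in> fp_words I H; i \<in> I\<rbrakk>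
    \<Longrightarrow> fp_eq I H (u @ (i, \<one>\<^bsub>H i\<^esub>) # v) (u @ v)"
| mult: "\<lbrakk>u \<in> fp_words I H; v \<in> fp_words I H; i \<in> I; x \<in> carrier (H i); y \<in> carrier (H i)\<rbrakk>
    \<Longrightarrow> fp_eq I H (u @ (i, x) # (i, y) # v) (u @ (i, x \<otimes>\<^bsub>H i\<^esub> y) # v)"

definition fp_class :: "'i set \<Rightarrow> ('i \<Rightarrow> ('a, 'b) monoid_scheme) \<Rightarrow> ('i \<times> 'a) list \<Rightarrow> ('i \<times> 'a) list set"
  where "fp_class I H w = {v. fp_eq I H w v}"

definition free_product :: "'i set \<Rightarrow> ('i \<Rightarrow> ('a, 'b) monoid_scheme) \<Rightarrow> ('i \<times> 'a) list set monoid"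
  where "free_product I H =
    \<lparr>carrier = fp_class I H ` fp_words I H,
     monoid.mult = (\<lambda>U V. {w. \<exists>u\<in>U. \<exists>v\<in>V. fp_eq I H (u @ v) w}),
     one = fp_class I H []\<rparr>"

definition fp_incl :: "'i set \<Rightarrow> ('i \<Rightarrow> ('a, 'b) monoid_scheme) \<Rightarrow> 'i \<Rightarrow> 'a \<Rightarrow> ('i \<times> 'a) list set"
  where "fp_incl I H i x = fp_class I H [(i, x)]"

definition fp_eval :: "('c, 'd) monoid_scheme \<Rightarrow> ('i \<Rightarrow> 'a \<Rightarrow> 'c) \<Rightarrow> ('i \<times> 'a) list \<Rightarrow> 'c"
  where "fp_eval K f w = foldr (\<lambda>(i, x) y. f i x \<otimes>\<^bsub>K\<^esub> y) w \<one>\<^bsub>K\<^esub>"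

text \<open>The homomorphism to \<open>K\<close> induced by a family of homomorphisms \<open>f i : H i \<rightarrow> K\<close>.\<close>

definition fp_lift :: "('c, 'd) monoid_scheme \<Rightarrow> ('i \<Rightarrow> 'a \<Rightarrow> 'c) \<Rightarrow> ('i \<times> 'a) list set \<Rightarrow> 'c"
  where "fp_lift K f U = the_elem (fp_eval K f ` U)"

lemma fp_words_simps [simp]:
  "[] \<in> fp_words I H"
  "(i, x) # w \<in> fp_words I H \<longleftrightarrow> i \<in> I \<and> x \<in> carrier (H i) \<and> w \<in> fp_words I H"
  "u @ v \<in> fp_words I H \<longleftrightarrow> u \<in> fp_words I H \<and> v \<in> fp_words I H"
  by (auto simp: fp_words_def)

locale fp_family =
  fixes I :: "'i set" and H :: "'i \<Rightarrow> ('a, 'b) monoid_scheme"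
  assumes grp: "\<And>i. i \<in> I \<Longrightarrow> group (H i)"
begin

lemma fp_eq_words: "fp_eq I H v w \<Longrightarrow> v \<in> fp_words I H \<and> w \<in> fp_words I H"
  by (induction rule: fp_eq.induct)
     (auto intro: monoid.m_closed[OF group.is_monoid[OF grp]] monoid.one_closed[OF group.is_monoid[OF grp]])

lemma fp_eq_context:
  assumes "fp_eq I H v w" "a \<in> fp_words I H" "b \<in> fp_words I H"
  shows "fp_eq I H (a @ v @ b) (a @ w @ b)"
  using assms
proof (induction rule: fp_eq.induct)
  case (refl w)
  then show ?case by (simp add: fp_eq.refl)
next
  case (sym v w)
  then show ?case by (blast intro: fp_eq.sym)
next
  case (trans u v w)
  then show ?case by (blast intro: fp_eq.trans)
next
  case (one u v i)
  then show ?case using fp_eq.one[of "a @ u" I H "v @ b" i] by simp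
next
  case (mult u v i x y)
  then show ?case using fp_eq.mult[of "a @ u" I H "v @ b" i x y] by simp
qed

lemma fp_eq_append:
  assumes "fp_eq I H v v'" "fp_eq I H w w'"
  shows "fp_eq I H (v @ w) (v' @ w')"
proof (rule fp_eq.trans)
  show "fp_eq I H (v @ w) (v' @ w)"
    using fp_eq_context[of v v' "[]" w] fp_eq_words assms by auto
  show "fp_eq I H (v' @ w) (v' @ w')"
    using fp_eq_context[of w w' v' "[]"] fp_eq_words assms by auto
qed

lemma fp_class_eq: "fp_eq I H v w \<Longrightarrow> fp_class I H v = fp_class I H w"
  unfolding fp_class_def by (blast intro: fp_eq.sym fp_eq.trans)

lemma free_product_mult:
  assumes "v \<in> fp_words I H" "w \<in> fp_words I H"
  shows "fp_class I H v \<otimes>\<^bsub>free_product I H\<^esub> fp_class I H w = fp_class I H (v @ w)"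
  using assms unfolding free_product_def fp_class_def
  by (auto intro: fp_eq.refl fp_eq.trans fp_eq_append)

lemma carrier_free_product: "carrier (free_product I H) = fp_class I H ` fp_words I H"
  by (simp add: free_product_def)

lemma one_free_product: "\<one>\<^bsub>free_product I H\<^esub> = fp_class I H []"
  by (simp add: free_product_def)

lemma fp_left_inverse:
  "w \<in> fp_words I H \<Longrightarrow> \<exists>v\<in>fp_words I H. fp_eq I H (v @ w) []"
proof (induction w)
  case Nil
  then show ?case by (force intro: fp_eq.refl)
next
  case (Cons p w)
  obtain i x where p: "p = (i, x)" by (cases p)
  with Cons obtain v where v: "v \<in> fp_words I H" "fp_eq I H (v @ w) []"
    and i: "i \<in> I" "x \<in> carrier (H i)" "w \<in> fp_words I H" by auto
  interpret group "H i" using grp i by blast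
  have "fp_eq I H (v @ (i, inv\<^bsub>H i\<^esub> x) # (i, x) # w) (v @ (i, inv\<^bsub>H i\<^esub> x \<otimes>\<^bsub>H i\<^esub> x) # w)"
    using v i by (intro fp_eq.mult) auto
  moreover have "fp_eq I H (v @ (i, inv\<^bsub>H i\<^esub> x \<otimes>\<^bsub>H i\<^esub> x) # w) (v @ w)"
    using v i fp_eq.one[of v I H w i] by simp
  ultimately have "fp_eq I H ((v @ [(i, inv\<^bsub>H i\<^esub> x)]) @ p # w) []"
    using v(2) p by (auto intro: fp_eq.trans)
  then show ?case using v i by (intro bexI[of _ "v @ [(i, inv\<^bsub>H i\<^esub> x)]"]) auto
qed

lemma group_free_product: "group (free_product I H)"
proof (rule groupI)
  fix U V W
  assume "U \<in> carrier (free_product I H)" "V \<in> carrier (free_product I H)"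
    "W \<in> carrier (free_product I H)"
  then show "U \<otimes>\<^bsub>free_product I H\<^esub> V \<otimes>\<^bsub>free_product I H\<^esub> W
      = U \<otimes>\<^bsub>free_product I H\<^esub> (V \<otimes>\<^bsub>free_product I H\<^esub> W)"
    by (auto simp: carrier_free_product free_product_mult)
next
  fix U assume "U \<in> carrier (free_product I H)"
  then obtain w where w: "w \<in> fp_words I H" "U = fp_class I H w"
    by (auto simp: carrier_free_product)
  then obtain v where "v \<in> fp_words I H" "fp_eq I H (v @ w) []" using fp_left_inverse by blast
  then show "\<exists>V\<in>carrier (free_product I H). V \<otimes>\<^bsub>free_product I H\<^esub> U = \<one>\<^bsub>free_product I H\<^esub>"
    using w by (auto simp: carrier_free_product free_product_mult one_free_product dest: fp_class_eq)
qed (auto simp: carrier_free_product free_product_mult one_free_product)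

lemma fp_incl_hom: "i \<in> I \<Longrightarrow> fp_incl I H i \<in> hom (H i) (free_product I H)"
  unfolding hom_def fp_incl_def
  using fp_eq.mult[of "[]" I H "[]" i, THEN fp_class_eq]
  by (auto simp: carrier_free_product free_product_mult)

context
  fixes K :: "('c, 'd) monoid_scheme" and f :: "'i \<Rightarrow> 'a \<Rightarrow> 'c"
  assumes K: "group K" and f: "\<And>i. i \<in> I \<Longrightarrow> f i \<in> hom (H i) K"
begin

interpretation K: group K by (rule K)

lemma fp_eval_closed: "w \<in> fp_words I H \<Longrightarrow> fp_eval K f w \<in> carrier K"
  by (induction w) (auto simp: fp_eval_def intro!: K.m_closed hom_in_carrier[OF f])

lemma fp_eval_append:
  "u \<in> fp_words I H \<Longrightarrow> v \<in> fp_words I H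
    \<Longrightarrow> fp_eval K f (u @ v) = fp_eval K f u \<otimes>\<^bsub>K\<^esub> fp_eval K f v"
proof (induction u)
  case Nil
  then show ?case using fp_eval_closed by (simp add: fp_eval_def)
next
  case (Cons p u)
  obtain i x where p: "p = (i, x)" by (cases p)
  then have "f i x \<in> carrier K" using f Cons by (auto dest: hom_in_carrier)
  then show ?case using Cons p fp_eval_closed[of u] fp_eval_closed[of v]
    by (simp add: fp_eval_def K.m_assoc)
qed

lemma fp_eval_cong: "fp_eq I H v w \<Longrightarrow> fp_eval K f v = fp_eval K f w"
proof (induction rule: fp_eq.induct)
  case (one u v i)
  have "f i \<one>\<^bsub>H i\<^esub> = \<one>\<^bsub>K\<^esub>" using hom_one[OF f grp K] one by blast
  moreover have "fp_eval K f ((i, \<one>\<^bsub>H i\<^esub>) # v) = f i \<one>\<^bsub>H i\<^esub> \<otimes>\<^bsub>K\<^esub> fp_eval K f v"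
    by (simp add: fp_eval_def)
  ultimately show ?case using one grp[of i] fp_eval_closed
    by (simp add: fp_eval_append group.is_monoid monoid.one_closed)
next
  case (mult u v i x y)
  then interpret Hi: group "H i" using grp by blast
  have c: "f i x \<in> carrier K" "f i y \<in> carrier K"
    using f mult by (auto dest: hom_in_carrier)
  have "f i (x \<otimes>\<^bsub>H i\<^esub> y) = f i x \<otimes>\<^bsub>K\<^esub> f i y"
    using f mult by (auto intro: hom_mult)
  then have "fp_eval K f ((i, x) # (i, y) # v) = fp_eval K f ((i, x \<otimes>\<^bsub>H i\<^esub> y) # v)"
    using c fp_eval_closed[of v] mult by (simp add: fp_eval_def K.m_assoc)
  then show ?case using mult by (simp add: fp_eval_append)
qed auto

lemma fp_lift_class: "w \<in> fp_words I H \<Longrightarrow> fp_lift K f (fp_class I H w) = fp_eval K f w"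
proof -
  assume w: "w \<in> fp_words I H"
  then have "fp_eval K f ` fp_class I H w = {fp_eval K f w}"
    by (auto simp: fp_class_def dest: fp_eval_cong intro: fp_eq.refl intro!: image_eqI[of _ _ w])
  then show ?thesis by (simp add: fp_lift_def)
qed

lemma fp_lift_hom: "fp_lift K f \<in> hom (free_product I H) K"
  by (rule homI) (auto simp: carrier_free_product free_product_mult fp_lift_class
      fp_eval_closed fp_eval_append)

lemma fp_lift_incl: "i \<in> I \<Longrightarrow> x \<in> carrier (H i) \<Longrightarrow> fp_lift K f (fp_incl I H i x) = f i x"
  using f[of i] by (simp add: fp_incl_def fp_lift_class fp_eval_def hom_in_carrier)

lemma fp_lift_unique:
  assumes h: "h \<in> hom (free_product I H) K"
    and eq: "\<And>i x. i \<in> I \<Longrightarrow> x \<in> carrier (H i) \<Longrightarrow> h (fp_incl I H i x) = f i x"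
    and U: "U \<in> carrier (free_product I H)"
  shows "h U = fp_lift K f U"
proof -
  have "h (fp_class I H w) = fp_eval K f w" if "w \<in> fp_words I H" for w
    using that
  proof (induction w)
    case Nil
    then show ?case
      using hom_one[OF h group_free_product K] by (simp add: one_free_product fp_eval_def)
  next
    case (Cons p w)
    obtain i x where p: "p = (i, x)" by (cases p)
    have "fp_class I H (p # w) = fp_incl I H i x \<otimes>\<^bsub>free_product I H\<^esub> fp_class I H w"
      using Cons p by (simp add: fp_incl_def free_product_mult)
    then have "h (fp_class I H (p # w)) = h (fp_incl I H i x) \<otimes>\<^bsub>K\<^esub> h (fp_class I H w)"
      using Cons p h by (simp add: hom_mult carrier_free_product fp_incl_def)
    then show ?case using Cons p eq by (simp add: fp_eval_def)
  qed
  then show ?thesis using U by (auto simp: carrier_free_product fp_lift_class)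
qed

end

end


section \<open>Active sums\<close>

definition conj_elt :: "('a, 'b) monoid_scheme \<Rightarrow> 'a \<Rightarrow> 'a \<Rightarrow> 'a"
  where "conj_elt G g h = inv\<^bsub>G\<^esub> h \<otimes>\<^bsub>G\<^esub> g \<otimes>\<^bsub>G\<^esub> h"

definition conj_subset :: "('a, 'b) monoid_scheme \<Rightarrow> 'a set \<Rightarrow> 'a \<Rightarrow> 'a set"
  where "conj_subset G F h = (\<lambda>g. conj_elt G g h) ` F"

definition normal_closure :: "('a, 'b) monoid_scheme \<Rightarrow> 'a set \<Rightarrow> 'a set"
  where "normal_closure G R = generate G {g \<otimes>\<^bsub>G\<^esub> r \<otimes>\<^bsub>G\<^esub> inv\<^bsub>G\<^esub> g | g r. g \<in> carrier G \<and> r \<in> R}"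

text \<open>A family of distinct subgroups is a set of subsets of \<open>G\<close>, indexed by itself in the free
  product; the elements \<open>fp_incl \<dots> F x\<close> for different \<open>F\<close> are thus kept apart.\<close>

abbreviation active_free_product ::
  "('a, 'b) monoid_scheme \<Rightarrow> 'a set set \<Rightarrow> ('a set \<times> 'a) list set monoid"
  where "active_free_product G \<F> \<equiv> free_product \<F> (\<lambda>F. G\<lparr>carrier := F\<rparr>)"

abbreviation active_incl ::
  "('a, 'b) monoid_scheme \<Rightarrow> 'a set set \<Rightarrow> 'a set \<Rightarrow> 'a \<Rightarrow> ('a set \<times> 'a) list set"
  where "active_incl G \<F> \<equiv> fp_incl \<F> (\<lambda>F. G\<lparr>carrier := F\<rparr>)"

definition active_relators ::
  "('a, 'b) monoid_scheme \<Rightarrow> 'a set set \<Rightarrow> ('a set \<times> 'a) list set set"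
  where "active_relators G \<F> =
    (let P = active_free_product G \<F>; \<iota> = active_incl G \<F> in
      {inv\<^bsub>P\<^esub> (\<iota> F1 h) \<otimes>\<^bsub>P\<^esub> \<iota> F2 g \<otimes>\<^bsub>P\<^esub> \<iota> F1 h
          \<otimes>\<^bsub>P\<^esub> inv\<^bsub>P\<^esub> (\<iota> (conj_subset G F2 h) (conj_elt G g h))
        | F1 F2 h g. F1 \<in> \<F> \<and> F2 \<in> \<F> \<and> h \<in> F1 \<and> g \<in> F2})"

definition active_sum ::
  "('a, 'b) monoid_scheme \<Rightarrow> 'a set set \<Rightarrow> ('a set \<times> 'a) list set set monoid"
  where "active_sum G \<F> =
    active_free_product G \<F> Mod normal_closure (active_free_product G \<F>) (active_relators G \<F>)"

definition active_sum_map :: "('a, 'b) monoid_scheme \<Rightarrow> ('a set \<times> 'a) list set set \<Rightarrow> 'a"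
  where "active_sum_map G C = the_elem (fp_lift G (\<lambda>F x. x) ` C)"

lemma (in group) normal_closure_normal:
  assumes "R \<subseteq> carrier G"
  shows "normal_closure G R \<lhd> G"
  unfolding normal_closure_def
proof (rule normal_generateI)
  show "{g \<otimes> r \<otimes> inv g |g r. g \<in> carrier G \<and> r \<in> R} \<subseteq> carrier G" using assms by auto
  fix h g assume h: "h \<in> {g \<otimes> r \<otimes> inv g |g r. g \<in> carrier G \<and> r \<in> R}" and g: "g \<in> carrier G"
  then obtain k r where k: "h = k \<otimes> r \<otimes> inv k" "k \<in> carrier G" "r \<in> R" by blast
  then have "g \<otimes> h \<otimes> inv g = (g \<otimes> k) \<otimes> r \<otimes> inv (g \<otimes> k)"
    using g assms by (auto simp: m_assoc inv_mult_group)
  then show "g \<otimes> h \<otimes> inv g \<in> {g \<otimes> r \<otimes> inv g |g r. g \<in> carrier G \<and> r \<in> R}"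
    using k g by blast
qed

lemma (in group) normal_closure_least:
  assumes "R \<subseteq> N" "N \<lhd> G"
  shows "normal_closure G R \<subseteq> N"
  unfolding normal_closure_def
proof (rule generate_subgroup_incl)
  show "{g \<otimes> r \<otimes> inv g |g r. g \<in> carrier G \<and> r \<in> R} \<subseteq> N"
    using assms normal.inv_op_closed2 by fast
  show "subgroup N G" using assms by (simp add: normal_imp_subgroup)
qed

lemma (in group) normal_closure_incl:
  assumes "R \<subseteq> carrier G"
  shows "R \<subseteq> normal_closure G R"
proof
  fix r assume "r \<in> R"
  then have "r = \<one> \<otimes> r \<otimes> inv \<one>" using assms by auto
  then show "r \<in> normal_closure G R"
    unfolding normal_closure_def using \<open>r \<in> R\<close> by (blast intro: generate.incl)
qed

locale active_family = group G for G :: "('a, 'b) monoid_scheme" (structure) +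
  fixes \<F> :: "'a set set"
  assumes subgroups: "\<And>F. F \<in> \<F> \<Longrightarrow> subgroup F G"
    and conj_closed: "\<And>F g. F \<in> \<F> \<Longrightarrow> g \<in> carrier G \<Longrightarrow> conj_subset G F g \<in> \<F>"
begin

sublocale fp: fp_family \<F> "\<lambda>F. G\<lparr>carrier := F\<rparr>"
  by (rule fp_family.intro) (simp add: subgroups subgroup_imp_group)

lemma incl_hom: "F \<in> \<F> \<Longrightarrow> (\<lambda>x. x) \<in> hom (G\<lparr>carrier := F\<rparr>) G"
  using subgroups by (force simp: hom_def dest: subgroup.mem_carrier)

abbreviation "P \<equiv> active_free_product G \<F>"

abbreviation "N \<equiv> normal_closure P (active_relators G \<F>)"

interpretation P: group P by (rule fp.group_free_product)

interpretation lift: group_hom P G "fp_lift G (\<lambda>F x. x)"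
  by unfold_locales (rule fp.fp_lift_hom[OF is_group incl_hom])

lemma active_incl_closed: "F \<in> \<F> \<Longrightarrow> x \<in> F \<Longrightarrow> active_incl G \<F> F x \<in> carrier P"
  using fp.fp_incl_hom[of F] by (auto simp: hom_def)

lemma lift_active_incl:
  "F \<in> \<F> \<Longrightarrow> x \<in> F \<Longrightarrow> fp_lift G (\<lambda>F x. x) (active_incl G \<F> F x) = x"
  using fp.fp_lift_incl[OF is_group incl_hom] by simp

lemma active_relators_kernel:
  "active_relators G \<F> \<subseteq> kernel P G (fp_lift G (\<lambda>F x. x))"
proof
  fix r assume "r \<in> active_relators G \<F>"
  then obtain F1 F2 h g where r: "r = inv\<^bsub>P\<^esub> (active_incl G \<F> F1 h) \<otimes>\<^bsub>P\<^esub> active_incl G \<F> F2 g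
      \<otimes>\<^bsub>P\<^esub> active_incl G \<F> F1 h \<otimes>\<^bsub>P\<^esub> inv\<^bsub>P\<^esub> (active_incl G \<F> (conj_subset G F2 h) (conj_elt G g h))"
    and *: "F1 \<in> \<F>" "F2 \<in> \<F>" "h \<in> F1" "g \<in> F2"
    unfolding active_relators_def Let_def by blast
  have hg: "h \<in> carrier G" "g \<in> carrier G" using * subgroups by (auto dest: subgroup.mem_carrier)
  have F: "conj_subset G F2 h \<in> \<F>" using * hg conj_closed by blast
  have c: "conj_elt G g h \<in> conj_subset G F2 h" using * by (simp add: conj_subset_def)
  show "r \<in> kernel P G (fp_lift G (\<lambda>F x. x))"
    using * hg F c unfolding kernel_def r
    by (simp add: active_incl_closed lift_active_incl conj_elt_def m_assoc[symmetric])
qed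

lemma normal_N: "N \<lhd> P"
  using active_relators_kernel by (intro P.normal_closure_normal) (auto simp: kernel_def)

lemma group_active_sum: "group (active_sum G \<F>)"
  unfolding active_sum_def by (rule normal.factorgroup_is_group[OF normal_N])

lemma N_kernel: "N \<subseteq> kernel P G (fp_lift G (\<lambda>F x. x))"
  by (rule P.normal_closure_least[OF active_relators_kernel lift.normal_kernel])

lemma active_sum_map_coset:
  assumes "U \<in> carrier P"
  shows "active_sum_map G (N #>\<^bsub>P\<^esub> U) = fp_lift G (\<lambda>F x. x) U"
proof -
  interpret N: normal N P by (rule normal_N)
  have "fp_lift G (\<lambda>F x. x) (V \<otimes>\<^bsub>P\<^esub> U) = fp_lift G (\<lambda>F x. x) U" if "V \<in> N" for V
    using that N_kernel assms by (auto simp: kernel_def)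
  then have "fp_lift G (\<lambda>F x. x) ` (N #>\<^bsub>P\<^esub> U) \<subseteq> {fp_lift G (\<lambda>F x. x) U}"
    by (auto simp: r_coset_def)
  moreover have "N #>\<^bsub>P\<^esub> U \<noteq> {}" using P.rcos_self[OF assms N.subgroup_axioms] by blast
  ultimately have "fp_lift G (\<lambda>F x. x) ` (N #>\<^bsub>P\<^esub> U) = {fp_lift G (\<lambda>F x. x) U}"
    by (simp add: subset_singleton_iff)
  then show ?thesis by (simp add: active_sum_map_def)
qed

lemma active_sum_map_hom: "active_sum_map G \<in> hom (active_sum G \<F>) G"
proof (rule homI)
  interpret N: normal N P by (rule normal_N)
  fix C D assume C: "C \<in> carrier (active_sum G \<F>)" and D: "D \<in> carrier (active_sum G \<F>)"
  then obtain U V where UV: "U \<in> carrier P" "V \<in> carrier P" "C = N #>\<^bsub>P\<^esub> U" "D = N #>\<^bsub>P\<^esub> V"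
    by (auto simp: active_sum_def carrier_FactGroup)
  then show "active_sum_map G (C \<otimes>\<^bsub>active_sum G \<F>\<^esub> D) = active_sum_map G C \<otimes> active_sum_map G D"
    by (simp add: active_sum_def N.rcos_sum active_sum_map_coset)
  show "active_sum_map G C \<in> carrier G"
    using UV by (simp add: active_sum_map_coset)
qed

lemma active_sum_map_incl:
  "F \<in> \<F> \<Longrightarrow> x \<in> F \<Longrightarrow> active_sum_map G (N #>\<^bsub>P\<^esub> active_incl G \<F> F x) = x"
  by (simp add: active_sum_map_coset active_incl_closed lift_active_incl)

lemma active_sum_map_unique:
  assumes h: "h \<in> hom (active_sum G \<F>) G"
    and eq: "\<And>F x. F \<in> \<F> \<Longrightarrow> x \<in> F \<Longrightarrow> h (N #>\<^bsub>P\<^esub> active_incl G \<F> F x) = x"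
    and C: "C \<in> carrier (active_sum G \<F>)"
  shows "h C = active_sum_map G C"
proof -
  interpret N: normal N P by (rule normal_N)
  have "(\<lambda>U. h (N #>\<^bsub>P\<^esub> U)) \<in> hom P G"
    using Group.hom_compose[OF N.r_coset_hom_Mod] h unfolding active_sum_def o_def by blast
  then have "h (N #>\<^bsub>P\<^esub> U) = fp_lift G (\<lambda>F x. x) U" if "U \<in> carrier P" for U
    using fp.fp_lift_unique[OF is_group incl_hom _ _ that, of "\<lambda>U. h (N #>\<^bsub>P\<^esub> U)"] eq by simp
  then show ?thesis using C by (auto simp: active_sum_def carrier_FactGroup active_sum_map_coset)
qed

lemma active_sum_map_surj:
  assumes "generate G (\<Union>\<F>) = carrier G"
  shows "active_sum_map G ` carrier (active_sum G \<F>) = carrier G"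
proof -
  interpret h: group_hom "active_sum G \<F>" G "active_sum_map G"
    using group_active_sum is_group active_sum_map_hom
    by (simp add: group_hom_def group_hom_axioms_def)
  have "\<Union>\<F> \<subseteq> active_sum_map G ` carrier (active_sum G \<F>)"
  proof
    fix x assume "x \<in> \<Union>\<F>"
    then obtain F where F: "F \<in> \<F>" "x \<in> F" by blast
    then have "N #>\<^bsub>P\<^esub> active_incl G \<F> F x \<in> carrier (active_sum G \<F>)"
      by (auto simp: active_sum_def carrier_FactGroup active_incl_closed)
    then show "x \<in> active_sum_map G ` carrier (active_sum G \<F>)"
      by (rule image_eqI[rotated]) (rule active_sum_map_incl[OF F, symmetric])
  qed
  then have "generate G (\<Union>\<F>) \<subseteq> active_sum_map G ` carrier (active_sum G \<F>)"
    by (rule generate_subgroup_incl) (rule h.img_is_subgroup)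
  then show ?thesis using assms active_sum_map_hom by (auto simp: hom_def)
qed

end


section \<open>Exponent and Schur multiplier\<close>

definition group_exponent :: "('a, 'b) monoid_scheme \<Rightarrow> nat"
  where "group_exponent K = Lcm (group.ord K ` carrier K)"

definition prime_divisors :: "nat \<Rightarrow> nat set"
  where "prime_divisors n = {p. prime p \<and> p dvd n}"

text \<open>The maps \<open>\<int>[K\<^sup>3] \<rightarrow> \<int>[K\<^sup>2] \<rightarrow> \<int>[K]\<close> of the complex obtained by applying
  \<open>\<int> \<otimes>\<^bsub>\<int>K\<^esub> -\<close> to the (unnormalised, inhomogeneous) bar resolution of \<open>\<int>\<close>.\<close>

definition bar_d2 :: "('a, 'b) monoid_scheme \<Rightarrow> ('a \<times> 'a \<Rightarrow>\<^sub>0 int) \<Rightarrow> ('a \<Rightarrow>\<^sub>0 int)"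
  where "bar_d2 K = frag_extend (\<lambda>(g, h). frag_of h - frag_of (g \<otimes>\<^bsub>K\<^esub> h) + frag_of g)"

definition bar_d3 :: "('a, 'b) monoid_scheme \<Rightarrow> ('a \<times> 'a \<times> 'a \<Rightarrow>\<^sub>0 int) \<Rightarrow> ('a \<times> 'a \<Rightarrow>\<^sub>0 int)"
  where "bar_d3 K = frag_extend (\<lambda>(g, h, k).
    frag_of (h, k) - frag_of (g \<otimes>\<^bsub>K\<^esub> h, k) + frag_of (g, h \<otimes>\<^bsub>K\<^esub> k) - frag_of (g, h))"

definition bar_cycles2 :: "('a, 'b) monoid_scheme \<Rightarrow> ('a \<times> 'a \<Rightarrow>\<^sub>0 int) set"
  where "bar_cycles2 K = kernel (free_Abelian_group (carrier K \<times> carrier K))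
    (free_Abelian_group (carrier K)) (bar_d2 K)"

definition bar_boundaries2 :: "('a, 'b) monoid_scheme \<Rightarrow> ('a \<times> 'a \<Rightarrow>\<^sub>0 int) set"
  where "bar_boundaries2 K =
    bar_d3 K ` carrier (free_Abelian_group (carrier K \<times> carrier K \<times> carrier K))"

definition schur_multiplier :: "('a, 'b) monoid_scheme \<Rightarrow> ('a \<times> 'a \<Rightarrow>\<^sub>0 int) set monoid"
  where "schur_multiplier K =
    (free_Abelian_group (carrier K \<times> carrier K))\<lparr>carrier := bar_cycles2 K\<rparr> Mod bar_boundaries2 K"

lemma bar_d2_closed:
  assumes "group K" "c \<in> carrier (free_Abelian_group (carrier K \<times> carrier K))"
  shows "bar_d2 K c \<in> carrier (free_Abelian_group (carrier K))"
proof -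
  interpret group K by (rule assms)
  have "Poly_Mapping.keys c \<subseteq> carrier K \<times> carrier K" using assms by simp
  then have "Poly_Mapping.keys (bar_d2 K c) \<subseteq> carrier K"
    unfolding bar_d2_def
    by (intro order_trans[OF keys_frag_extend] UN_least)
       (force dest!: keys_diff[THEN subsetD] Poly_Mapping.keys_add[THEN subsetD])
  then show ?thesis by simp
qed

lemma bar_d3_closed:
  assumes "group K" "c \<in> carrier (free_Abelian_group (carrier K \<times> carrier K \<times> carrier K))"
  shows "bar_d3 K c \<in> carrier (free_Abelian_group (carrier K \<times> carrier K))"
proof -
  interpret group K by (rule assms)
  have "Poly_Mapping.keys c \<subseteq> carrier K \<times> carrier K \<times> carrier K" using assms by simp
  then have "Poly_Mapping.keys (bar_d3 K c) \<subseteq> carrier K \<times> carrier K"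
    unfolding bar_d3_def
    by (intro order_trans[OF keys_frag_extend] UN_least)
       (force dest!: keys_diff[THEN subsetD] Poly_Mapping.keys_add[THEN subsetD])
  then show ?thesis by simp
qed

lemma bar_d2_d3:
  assumes "group K" "c \<in> carrier (free_Abelian_group (carrier K \<times> carrier K \<times> carrier K))"
  shows "bar_d2 K (bar_d3 K c) = 0"
proof -
  interpret group K by (rule assms)
  have "Poly_Mapping.keys c \<subseteq> carrier K \<times> carrier K \<times> carrier K" using assms by simp
  then show ?thesis
  proof (induction c rule: frag_induction)
    case (one x)
    then show ?case
      by (auto simp: bar_d2_def bar_d3_def frag_extend_diff frag_extend_add m_assoc)
  qed (simp_all add: bar_d2_def bar_d3_def frag_extend_diff)
qed

lemma comm_group_schur_multiplier:
  assumes "group K"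
  shows "comm_group (schur_multiplier K)"
proof -
  let ?C1 = "free_Abelian_group (carrier K)"
  let ?C2 = "free_Abelian_group (carrier K \<times> carrier K)"
  let ?C3 = "free_Abelian_group (carrier K \<times> carrier K \<times> carrier K)"
  interpret d2: group_hom ?C2 ?C1 "bar_d2 K"
    unfolding group_hom_def group_hom_axioms_def hom_def
    using bar_d2_closed[OF assms] by (auto simp: bar_d2_def frag_extend_add)
  interpret d3: group_hom ?C3 ?C2 "bar_d3 K"
    unfolding group_hom_def group_hom_axioms_def hom_def
    using bar_d3_closed[OF assms] by (auto simp: bar_d3_def frag_extend_add)
  have Z: "subgroup (bar_cycles2 K) ?C2"
    unfolding bar_cycles2_def by (rule d2.subgroup_kernel)
  have B: "subgroup (bar_boundaries2 K) ?C2"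
    unfolding bar_boundaries2_def by (rule d3.img_is_subgroup)
  have BZ: "bar_boundaries2 K \<subseteq> bar_cycles2 K"
    unfolding bar_cycles2_def bar_boundaries2_def kernel_def
    using bar_d3_closed[OF assms] bar_d2_d3[OF assms] by (simp add: image_subset_iff)
  have comm: "comm_group (?C2\<lparr>carrier := bar_cycles2 K\<rparr>)"
    by (rule group.group_comm_groupI[OF group.subgroup_imp_group[OF group_free_Abelian_group Z]])
       (simp add: add.commute)
  have "subgroup (bar_boundaries2 K) (?C2\<lparr>carrier := bar_cycles2 K\<rparr>)"
    by (rule group.subgroup_incl[OF group_free_Abelian_group B Z BZ])
  then show ?thesis
    unfolding schur_multiplier_def by (rule comm_group.abelian_FactGroup[OF comm])
qed


section \<open>Cellular groups\<close>

text \<open>Functions on a carrier are determined only up to their values outside of it, so \<open>Hom(A, X)\<close>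
  consists of the homomorphisms that are \<open>undefined\<close> outside \<open>carrier A\<close>.\<close>

definition Hom_set :: "('h, 'c) monoid_scheme \<Rightarrow> ('x, 'd) monoid_scheme \<Rightarrow> ('h \<Rightarrow> 'x) set"
  where "Hom_set A X = hom A X \<inter> extensional (carrier A)"

definition Hom_map :: "('h, 'c) monoid_scheme \<Rightarrow> ('x \<Rightarrow> 'y) \<Rightarrow> ('h \<Rightarrow> 'x) \<Rightarrow> ('h \<Rightarrow> 'y)"
  where "Hom_map A f t = compose (carrier A) f t"

definition equivalence_wrt ::
  "('h, 'c) monoid_scheme \<Rightarrow> ('x, 'd) monoid_scheme \<Rightarrow> ('y, 'e) monoid_scheme \<Rightarrow> ('x \<Rightarrow> 'y) \<Rightarrow> bool"
  where "equivalence_wrt A X Y f \<longleftrightarrow> bij_betw (Hom_map A f) (Hom_set A X) (Hom_set A Y)"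

definition injection_wrt ::
  "('h, 'c) monoid_scheme \<Rightarrow> ('x, 'd) monoid_scheme \<Rightarrow> ('x \<Rightarrow> 'y) \<Rightarrow> bool"
  where "injection_wrt A X f \<longleftrightarrow> inj_on (Hom_map A f) (Hom_set A X)"

text \<open>HOL cannot quantify over the types carrying the groups \<open>X\<close> and \<open>Y\<close>, so the type is a
  parameter. For finite \<open>A\<close> and \<open>H\<close> all infinite types give the same notion; see
  \<open>cellular_change_type\<close> below.\<close>

definition cellular ::
  "'u::infinite itself \<Rightarrow> ('a, 'c) monoid_scheme \<Rightarrow> ('h, 'd) monoid_scheme \<Rightarrow> bool"
  where "cellular (_ :: 'u itself) A H \<longleftrightarrow>
    (\<forall>(X :: 'u monoid) (Y :: 'u monoid) f.
      group X \<longrightarrow> group Y \<longrightarrow> f \<in> hom X Y \<longrightarrow> equivalence_wrt A X Y f \<longrightarrow> equivalence_wrt H X Y f)"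

lemma Hom_map_in:
  "group A \<Longrightarrow> f \<in> hom X Y \<Longrightarrow> t \<in> Hom_set A X \<Longrightarrow> Hom_map A f t \<in> Hom_set A Y"
  unfolding Hom_set_def Hom_map_def
  by (auto simp: hom_def compose_def Pi_iff monoid.m_closed[OF group.is_monoid])

lemma Hom_set_eqI:
  "s \<in> Hom_set A X \<Longrightarrow> t \<in> Hom_set A X' \<Longrightarrow> (\<And>a. a \<in> carrier A \<Longrightarrow> s a = t a) \<Longrightarrow> s = t"
  unfolding Hom_set_def by (auto intro: extensionalityI)

lemma Hom_set_carrier:
  "t \<in> Hom_set A X \<Longrightarrow> a \<in> carrier A \<Longrightarrow> t a \<in> carrier X"
  unfolding Hom_set_def by (auto simp: hom_def)

lemma Hom_set_subgroup:
  assumes "S \<subseteq> carrier X"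
  shows "t \<in> Hom_set A (X\<lparr>carrier := S\<rparr>) \<longleftrightarrow> t \<in> Hom_set A X \<and> t ` carrier A \<subseteq> S"
  using assms unfolding Hom_set_def hom_def by (auto simp: Pi_iff subset_iff)

lemma equivalence_wrt_iff:
  assumes "group A" "f \<in> hom X Y"
  shows "equivalence_wrt A X Y f \<longleftrightarrow>
    inj_on (Hom_map A f) (Hom_set A X) \<and> (\<forall>u\<in>Hom_set A Y. \<exists>t\<in>Hom_set A X. Hom_map A f t = u)"
  unfolding equivalence_wrt_def bij_betw_def by (auto simp: set_eq_iff image_iff Hom_map_in[OF assms]) metis+

lemma bij_Hom_map_iso:
  assumes A: "group A" and "group X" "d \<in> iso X X'"
  shows "bij_betw (Hom_map A d) (Hom_set A X) (Hom_set A X')"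
proof (rule bij_betw_byWitness[where f' = "Hom_map A (inv_into (carrier X) d)"])
  have bij: "bij_betw d (carrier X) (carrier X')" and d: "d \<in> hom X X'"
    using assms by (auto simp: iso_def)
  have e: "inv_into (carrier X) d \<in> hom X' X"
    using group.iso_set_sym[OF assms(2,3)] by (simp add: iso_def)
  show "Hom_map A d ` Hom_set A X \<subseteq> Hom_set A X'" using Hom_map_in[OF A d] by blast
  show "Hom_map A (inv_into (carrier X) d) ` Hom_set A X' \<subseteq> Hom_set A X"
    using Hom_map_in[OF A e] by blast
  show "\<forall>t\<in>Hom_set A X. Hom_map A (inv_into (carrier X) d) (Hom_map A d t) = t"
  proof
    fix t assume t: "t \<in> Hom_set A X"
    show "Hom_map A (inv_into (carrier X) d) (Hom_map A d t) = t"
      using t by (rule Hom_set_eqI[OF Hom_map_in[OF A e Hom_map_in[OF A d]]])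
        (use t bij in \<open>auto simp: Hom_map_def compose_def Hom_set_carrier bij_betw_def\<close>)
  qed
  show "\<forall>t\<in>Hom_set A X'. Hom_map A d (Hom_map A (inv_into (carrier X) d) t) = t"
  proof
    fix t assume t: "t \<in> Hom_set A X'"
    show "Hom_map A d (Hom_map A (inv_into (carrier X) d) t) = t"
      using t by (rule Hom_set_eqI[OF Hom_map_in[OF A d Hom_map_in[OF A e]]])
        (use t bij in \<open>auto simp: Hom_map_def compose_def Hom_set_carrier bij_betw_def f_inv_into_f\<close>)
  qed
qed

lemma equivalence_wrt_transport:
  assumes A: "group A" and "group X" "group Y" "f \<in> hom X Y" "d \<in> iso X X'" "e \<in> iso Y Y'"
    "f' \<in> hom X' Y'" "\<And>x. x \<in> carrier X \<Longrightarrow> f' (d x) = e (f x)"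
  shows "equivalence_wrt A X Y f \<longleftrightarrow> equivalence_wrt A X' Y' f'"
proof -
  have d: "bij_betw (Hom_map A d) (Hom_set A X) (Hom_set A X')"
    and e: "bij_betw (Hom_map A e) (Hom_set A Y) (Hom_set A Y')"
    using assms bij_Hom_map_iso by blast+
  have eq: "Hom_map A f' (Hom_map A d t) = Hom_map A e (Hom_map A f t)" if "t \<in> Hom_set A X" for t
    using assms(8) that by (auto simp: Hom_map_def compose_def Hom_set_carrier)
  have "equivalence_wrt A X Y f \<longleftrightarrow> bij_betw (Hom_map A e \<circ> Hom_map A f) (Hom_set A X) (Hom_set A Y')"
    unfolding equivalence_wrt_def
    by (rule bij_betw_comp_iff2[OF e]) (use Hom_map_in[OF A assms(4)] in blast)
  also have "\<dots> \<longleftrightarrow> bij_betw (Hom_map A f' \<circ> Hom_map A d) (Hom_set A X) (Hom_set A Y')"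
    by (rule bij_betw_cong) (simp add: eq)
  also have "\<dots> \<longleftrightarrow> equivalence_wrt A X' Y' f'"
    unfolding equivalence_wrt_def by (rule bij_betw_comp_iff[OF d, symmetric])
  finally show ?thesis .
qed

lemma countable_group_copy:
  assumes "group X" "countable (carrier X)"
  obtains X' :: "'u::infinite monoid" and d where "group X'" "d \<in> iso X X'"
proof -
  interpret group X by (rule assms)
  obtain g :: "nat \<Rightarrow> 'u" where g: "inj g"
    using arb_countable_map[of "{}"] by auto
  define d where "d = g \<circ> to_nat_on (carrier X)"
  have d: "inj_on d (carrier X)"
    unfolding d_def using g assms(2) by (auto intro: comp_inj_on inj_on_subset)
  show thesis
    by (rule that[OF inj_imp_image_group_is_group[OF d] inj_imp_image_group_iso[OF d]])
qed

lemma countable_equivalence: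
  fixes X :: "('x, 'c) monoid_scheme" and Y :: "('y, 'd) monoid_scheme"
  assumes A: "group A" and "group X" "group Y" and f: "f \<in> hom X Y" and fin: "finite (carrier A)"
    and equiv: "equivalence_wrt A X Y f"
    and X0: "X0 \<subseteq> carrier X" "countable X0" and Y0: "Y0 \<subseteq> carrier Y" "countable Y0"
  obtains X1 Y1 where "subgroup X1 X" "subgroup Y1 Y" "countable X1" "countable Y1"
    "X0 \<subseteq> X1" "Y0 \<subseteq> Y1" "f ` X1 \<subseteq> Y1"
    "equivalence_wrt A (X\<lparr>carrier := X1\<rparr>) (Y\<lparr>carrier := Y1\<rparr>) f"
proof -
  interpret X: group X by (rule assms)
  interpret Y: group Y by (rule assms)
  have inj: "inj_on (Hom_map A f) (Hom_set A X)"
    and lift: "\<And>u. u \<in> Hom_set A Y \<Longrightarrow> \<exists>t\<in>Hom_set A X. Hom_map A f t = u"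
    using equiv unfolding equivalence_wrt_iff[OF A f] by auto
  define T where "T Q = {t \<in> Hom_set A X. Hom_map A f t ` carrier A \<subseteq> Q}" for Q
  define PX where "PX P Q = insert \<one>\<^bsub>X\<^esub> (P \<union> m_inv X ` P \<union> (\<lambda>(x, y). x \<otimes>\<^bsub>X\<^esub> y) ` (P \<times> P)
    \<union> (\<Union>t\<in>T Q. t ` carrier A))" for P Q
  define PY where "PY P Q = insert \<one>\<^bsub>Y\<^esub> (Q \<union> m_inv Y ` Q \<union> (\<lambda>(x, y). x \<otimes>\<^bsub>Y\<^esub> y) ` (Q \<times> Q)
    \<union> f ` P)" for P Q
  define S where "S = rec_nat (X0, Y0) (\<lambda>_ (P, Q). (PX P Q, PY P Q))"
  have S0: "S 0 = (X0, Y0)" by (simp add: S_def)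
  have SS: "S (Suc k) = (PX (fst (S k)) (snd (S k)), PY (fst (S k)) (snd (S k)))" for k
    by (simp add: S_def split: prod.split)
  obtain as where as: "set as = carrier A" using finite_list[OF fin] by blast
  have cT: "countable (T Q)" if "countable Q" for Q
  proof (rule countable_image_inj_on)
    have "(\<lambda>t. map (Hom_map A f t) as) ` T Q \<subseteq> lists Q"
      using as by (auto simp: T_def)
    then show "countable ((\<lambda>t. map (Hom_map A f t) as) ` T Q)"
      using countable_lists[OF that] countable_subset by blast
    show "inj_on (\<lambda>t. map (Hom_map A f t) as) (T Q)"
    proof (rule inj_onI)
      fix s t assume st: "s \<in> T Q" "t \<in> T Q" "map (Hom_map A f s) as = map (Hom_map A f t) as"
      then have "Hom_map A f s = Hom_map A f t"
        by (intro Hom_set_eqI[of _ A Y _ Y] Hom_map_in[OF A f]) (auto simp: T_def as)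
      then show "s = t" using st inj by (auto simp: T_def dest: inj_onD)
    qed
  qed
  have cS: "countable (fst (S k)) \<and> countable (snd (S k))" for k
    by (induction k) (use X0 Y0 cT fin in \<open>auto simp: S0 SS PX_def PY_def intro!: countable_UN
        dest: uncountable_infinite\<close>)
  have sub: "fst (S k) \<subseteq> carrier X \<and> snd (S k) \<subseteq> carrier Y" for k
  proof (induction k)
    case (Suc k)
    have "f ` fst (S k) \<subseteq> carrier Y" using Suc f by (auto simp: hom_def)
    then show ?case using Suc
      by (auto simp: SS PX_def PY_def T_def Hom_set_carrier)
  qed (use X0 Y0 in \<open>simp add: S0\<close>)
  have stepX: "fst (S k) \<subseteq> fst (S (Suc k))" and stepY: "snd (S k) \<subseteq> snd (S (Suc k))" for k
    by (auto simp: SS PX_def PY_def)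
  have monoX: "fst (S k) \<subseteq> fst (S l)" and monoY: "snd (S k) \<subseteq> snd (S l)" if "k \<le> l" for k l
    using lift_Suc_mono_le[of "\<lambda>k. fst (S k)", OF stepX that]
      lift_Suc_mono_le[of "\<lambda>k. snd (S k)", OF stepY that] by auto
  define X1 where "X1 = (\<Union>k. fst (S k))"
  define Y1 where "Y1 = (\<Union>k. snd (S k))"
  have subX: "subgroup X1 X"
  proof
    show "X1 \<subseteq> carrier X" using sub by (auto simp: X1_def)
    have "\<one>\<^bsub>X\<^esub> \<in> fst (S (Suc 0))" by (simp add: SS PX_def)
    then show "\<one>\<^bsub>X\<^esub> \<in> X1" unfolding X1_def by blast
    fix x assume "x \<in> X1"
    then obtain k where k: "x \<in> fst (S k)" by (auto simp: X1_def)
    then have "inv\<^bsub>X\<^esub> x \<in> fst (S (Suc k))" by (simp add: SS PX_def)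
    then show "inv\<^bsub>X\<^esub> x \<in> X1" unfolding X1_def by blast
    fix y assume "y \<in> X1"
    then obtain l where "y \<in> fst (S l)" by (auto simp: X1_def)
    then have "x \<in> fst (S (max k l))" "y \<in> fst (S (max k l))"
      using k monoX[of k "max k l"] monoX[of l "max k l"] by auto
    then have "x \<otimes>\<^bsub>X\<^esub> y \<in> fst (S (Suc (max k l)))" by (force simp: SS PX_def)
    then show "x \<otimes>\<^bsub>X\<^esub> y \<in> X1" unfolding X1_def by blast
  qed
  have subY: "subgroup Y1 Y"
  proof
    show "Y1 \<subseteq> carrier Y" using sub by (auto simp: Y1_def)
    have "\<one>\<^bsub>Y\<^esub> \<in> snd (S (Suc 0))" by (simp add: SS PY_def)
    then show "\<one>\<^bsub>Y\<^esub> \<in> Y1" unfolding Y1_def by blast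
    fix x assume "x \<in> Y1"
    then obtain k where k: "x \<in> snd (S k)" by (auto simp: Y1_def)
    then have "inv\<^bsub>Y\<^esub> x \<in> snd (S (Suc k))" by (simp add: SS PY_def)
    then show "inv\<^bsub>Y\<^esub> x \<in> Y1" unfolding Y1_def by blast
    fix y assume "y \<in> Y1"
    then obtain l where "y \<in> snd (S l)" by (auto simp: Y1_def)
    then have "x \<in> snd (S (max k l))" "y \<in> snd (S (max k l))"
      using k monoY[of k "max k l"] monoY[of l "max k l"] by auto
    then have "x \<otimes>\<^bsub>Y\<^esub> y \<in> snd (S (Suc (max k l)))" by (force simp: SS PY_def)
    then show "x \<otimes>\<^bsub>Y\<^esub> y \<in> Y1" unfolding Y1_def by blast
  qed
  have fX1: "f ` X1 \<subseteq> Y1"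
  proof
    fix y assume "y \<in> f ` X1"
    then obtain k where "y \<in> f ` fst (S k)" by (auto simp: X1_def)
    then have "y \<in> snd (S (Suc k))" by (simp add: SS PY_def)
    then show "y \<in> Y1" unfolding Y1_def by blast
  qed
  note inX = Hom_set_subgroup[OF subgroup.subset[OF subX]]
  note inY = Hom_set_subgroup[OF subgroup.subset[OF subY]]
  have f1: "f \<in> hom (X\<lparr>carrier := X1\<rparr>) (Y\<lparr>carrier := Y1\<rparr>)"
    using f fX1 subgroup.subset[OF subX] by (auto simp: hom_def subset_iff)
  have "equivalence_wrt A (X\<lparr>carrier := X1\<rparr>) (Y\<lparr>carrier := Y1\<rparr>) f"
    unfolding equivalence_wrt_iff[OF A f1]
  proof (intro conjI ballI)
    show "inj_on (Hom_map A f) (Hom_set A (X\<lparr>carrier := X1\<rparr>))"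
      using inj by (rule inj_on_subset) (auto simp: inX)
    fix u assume "u \<in> Hom_set A (Y\<lparr>carrier := Y1\<rparr>)"
    then have u: "u \<in> Hom_set A Y" "u ` carrier A \<subseteq> Y1" by (auto simp: inY)
    obtain t where t: "t \<in> Hom_set A X" "Hom_map A f t = u" using lift u by blast
    have "\<forall>a\<in>carrier A. \<exists>k. u a \<in> snd (S k)" using u(2) by (auto simp: Y1_def)
    then obtain \<kappa> where \<kappa>: "\<And>a. a \<in> carrier A \<Longrightarrow> u a \<in> snd (S (\<kappa> a))" by metis
    define k where "k = Max (\<kappa> ` carrier A)"
    have "u ` carrier A \<subseteq> snd (S k)"
    proof
      fix y assume "y \<in> u ` carrier A"
      then obtain a where a: "a \<in> carrier A" "y = u a" by blast
      then have "\<kappa> a \<le> k" using fin by (simp add: k_def)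
      then show "y \<in> snd (S k)" using \<kappa> a monoY by blast
    qed
    then have "t \<in> T (snd (S k))" using t by (simp add: T_def)
    then have "t ` carrier A \<subseteq> fst (S (Suc k))" by (auto simp: SS PX_def)
    then have "t ` carrier A \<subseteq> X1" unfolding X1_def by blast
    then show "\<exists>t\<in>Hom_set A (X\<lparr>carrier := X1\<rparr>). Hom_map A f t = u" using t inX by blast
  qed
  moreover have "X0 \<subseteq> X1" "Y0 \<subseteq> Y1" using S0 unfolding X1_def Y1_def by (metis UN_upper UNIV_I fst_conv snd_conv)+
  moreover have "countable X1" "countable Y1" using cS by (auto simp: X1_def Y1_def)
  ultimately show thesis using that subX subY fX1 by blast
qed

theorem cellular_change_type:
  fixes A :: "('a, 'c) monoid_scheme" and H :: "('h, 'd) monoid_scheme"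
  assumes A: "group A" and H: "group H" and finA: "finite (carrier A)" and finH: "finite (carrier H)"
    and cell: "cellular TYPE('u::infinite) A H"
  shows "cellular TYPE('v::infinite) A H"
  unfolding cellular_def
proof (intro allI impI)
  fix X Y :: "'v monoid" and f
  assume X: "group X" and Y: "group Y" and f: "f \<in> hom X Y" and equiv: "equivalence_wrt A X Y f"
  have small: "\<exists>X1 Y1. X1 \<subseteq> carrier X \<and> Y1 \<subseteq> carrier Y \<and> X0 \<subseteq> X1 \<and> Y0 \<subseteq> Y1
      \<and> f \<in> hom (X\<lparr>carrier := X1\<rparr>) (Y\<lparr>carrier := Y1\<rparr>)
      \<and> equivalence_wrt H (X\<lparr>carrier := X1\<rparr>) (Y\<lparr>carrier := Y1\<rparr>) f"
    if "X0 \<subseteq> carrier X" "countable X0" "Y0 \<subseteq> carrier Y" "countable Y0" for X0 Y0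
  proof -
    obtain X1 Y1 where *: "subgroup X1 X" "subgroup Y1 Y" "countable X1" "countable Y1"
      "X0 \<subseteq> X1" "Y0 \<subseteq> Y1" "f ` X1 \<subseteq> Y1"
      "equivalence_wrt A (X\<lparr>carrier := X1\<rparr>) (Y\<lparr>carrier := Y1\<rparr>) f"
      using countable_equivalence[OF A X Y f finA equiv \<open>X0 \<subseteq> carrier X\<close> \<open>countable X0\<close>
        \<open>Y0 \<subseteq> carrier Y\<close> \<open>countable Y0\<close>] by metis
    let ?X = "X\<lparr>carrier := X1\<rparr>" and ?Y = "Y\<lparr>carrier := Y1\<rparr>"
    have sub: "X1 \<subseteq> carrier X" "Y1 \<subseteq> carrier Y" using * by (auto dest: subgroup.subset)
    have grp: "group ?X" "group ?Y"
      using * X Y by (auto intro: group.subgroup_imp_group)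
    have f1: "f \<in> hom ?X ?Y" using f * sub by (auto simp: hom_def subset_iff)
    obtain X' :: "'u monoid" and d where X': "group X'" "d \<in> iso ?X X'"
      using countable_group_copy[OF grp(1)] * by auto
    obtain Y' :: "'u monoid" and e where Y': "group Y'" "e \<in> iso ?Y Y'"
      using countable_group_copy[OF grp(2)] * by auto
    define f' where "f' = e \<circ> (f \<circ> inv_into X1 d)"
    have "inv_into X1 d \<in> hom X' ?X"
      using group.iso_set_sym[OF grp(1) X'(2)] by (simp add: iso_def)
    then have f': "f' \<in> hom X' Y'"
      unfolding f'_def using f1 Y'(2) by (auto intro!: hom_compose simp: iso_def)
    have "f' (d x) = e (f x)" if "x \<in> carrier ?X" for x
      using that X'(2) by (simp add: f'_def iso_def bij_betw_def)
    note tr = equivalence_wrt_transport[OF _ grp f1 X'(2) Y'(2) f' this]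
    have "equivalence_wrt H X' Y' f'"
      using cell X' Y' f' tr[OF A] *(8) unfolding cellular_def by blast
    then show ?thesis using tr[OF H] * sub f1 by blast
  qed
  show "equivalence_wrt H X Y f"
    unfolding equivalence_wrt_iff[OF H f]
  proof (intro conjI ballI inj_onI)
    fix s t assume st: "s \<in> Hom_set H X" "t \<in> Hom_set H X" "Hom_map H f s = Hom_map H f t"
    have "s ` carrier H \<union> t ` carrier H \<subseteq> carrier X"
      using st by (auto intro: Hom_set_carrier)
    then obtain X1 Y1 where 1: "X1 \<subseteq> carrier X" "s ` carrier H \<union> t ` carrier H \<subseteq> X1"
      "f \<in> hom (X\<lparr>carrier := X1\<rparr>) (Y\<lparr>carrier := Y1\<rparr>)"
      "equivalence_wrt H (X\<lparr>carrier := X1\<rparr>) (Y\<lparr>carrier := Y1\<rparr>) f"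
      using small[of "s ` carrier H \<union> t ` carrier H" "{}"] finH by (auto simp: countable_finite)
    then have "s \<in> Hom_set H (X\<lparr>carrier := X1\<rparr>)" "t \<in> Hom_set H (X\<lparr>carrier := X1\<rparr>)"
      using st by (auto simp: Hom_set_subgroup)
    then show "s = t"
      using 1(4) st(3) unfolding equivalence_wrt_iff[OF H 1(3)] by (auto dest: inj_onD)
  next
    fix u assume u: "u \<in> Hom_set H Y"
    then have "u ` carrier H \<subseteq> carrier Y" by (auto intro: Hom_set_carrier)
    then obtain X1 Y1 where 1: "X1 \<subseteq> carrier X" "Y1 \<subseteq> carrier Y" "u ` carrier H \<subseteq> Y1"
      "f \<in> hom (X\<lparr>carrier := X1\<rparr>) (Y\<lparr>carrier := Y1\<rparr>)"
      "equivalence_wrt H (X\<lparr>carrier := X1\<rparr>) (Y\<lparr>carrier := Y1\<rparr>) f"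
      using small[of "{}" "u ` carrier H"] finH by (auto simp: countable_finite)
    then have "u \<in> Hom_set H (Y\<lparr>carrier := Y1\<rparr>)" using u by (simp add: Hom_set_subgroup)
    then obtain t where "t \<in> Hom_set H (X\<lparr>carrier := X1\<rparr>)" "Hom_map H f t = u"
      using 1(5) unfolding equivalence_wrt_iff[OF H 1(4)] by blast
    then show "\<exists>t\<in>Hom_set H X. Hom_map H f t = u" using 1(1) by (auto simp: Hom_set_subgroup)
  qed
qed

end

theory Submission
  imports Defs
begin

text \<open>
  The kernel \<open>K\<close> of \<open>\<phi> : S \<rightarrow> G\<close> is central: conjugating a generator of \<open>S\<close>, an element \<open>x\<close> of a
  factor \<open>F\<close>, by \<open>s\<close> gives the element \<open>x\<^sup>g\<close> of the factor \<open>F\<^sup>g\<close>, where \<open>g = \<phi>(s)\<close>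
  (\<open>conj_gen\<close>), so elements of \<open>K\<close> commute with all generators (\<open>kernel_central\<close>).

  For every central extension there is a surjection \<open>H\<^sub>2(G) \<rightarrow> K \<inter> [S,S]\<close>, part of the five-term
  exact sequence in homology. Hence \<open>K \<inter> [S,S]\<close> is annihilated by \<open>m = |H\<^sub>2(G)|\<close>
  (\<open>kernel_Int_derived_torsion\<close>). On the other hand, \<open>S\<close> is generated by elements whose \<open>n\<close>-th
  powers are trivial, and therefore \<open>n\<close> annihilates \<open>S/[S,S]\<close> (\<open>pow_in_derived\<close>). So \<open>k\<^sup>n\<close> lies
  in \<open>K \<inter> [S,S]\<close> for each \<open>k\<close> in \<open>K\<close>, and \<open>(k\<^sup>n)\<^sup>m = 1\<close>.

  A \<open>C\<^sub>n\<close>-injection cannot kill an element of order dividing \<open>n\<close> other than \<open>1\<close>, because such an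
  element is the image of a generator of \<open>C\<^sub>n\<close> (\<open>cyclic_injection_kernel\<close>). In particular \<open>K\<close> has
  no \<open>p\<close>-torsion for primes \<open>p\<close> dividing \<open>n\<close>. Since all primes dividing \<open>m\<close> divide \<open>n\<close>, this
  yields first \<open>k\<^sup>n = 1\<close> and then \<open>k = 1\<close>.
\<close>

section \<open>Abelianization\<close>

lemma comm_group_DirProd:
  assumes "comm_group G" "comm_group H"
  shows "comm_group (G \<times>\<times> H)"
proof -
  interpret G: comm_group G by (rule assms)
  interpret H: comm_group H by (rule assms)
  show ?thesis
    by (rule group.group_comm_groupI[OF DirProd_group[OF G.is_group H.is_group]])
       (auto simp: G.m_comm H.m_comm)
qed

lemma (in group_hom) derived_le_kernel:
  assumes "comm_group H"
  shows "derived G (carrier G) \<subseteq> kernel G H h"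
proof -
  interpret H: comm_group H by (rule assms)
  have "h (x \<otimes> y \<otimes> inv x \<otimes> inv y) = \<one>\<^bsub>H\<^esub>" if "x \<in> carrier G" "y \<in> carrier G" for x y
    using that by (simp add: H.m_comm[of "h x" "h y"] H.m_assoc)
  then show ?thesis
    unfolding derived_def
    by (intro G.generate_subgroup_incl subgroup_kernel) (auto simp: kernel_def)
qed

lemma (in group) comm_group_abelianization:
  "comm_group (G Mod derived G (carrier G))"
proof -
  interpret D: normal "derived G (carrier G)" G by (rule derived_self_is_normal)
  show ?thesis
  proof (rule group.group_comm_groupI[OF D.factorgroup_is_group])
    fix U V assume "U \<in> carrier (G Mod derived G (carrier G))" "V \<in> carrier (G Mod derived G (carrier G))"
    then obtain x y where xy: "x \<in> carrier G" "y \<in> carrier G"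
      "U = derived G (carrier G) #> x" "V = derived G (carrier G) #> y"
      by (auto simp: carrier_FactGroup)
    have "x \<otimes> y \<otimes> inv x \<otimes> inv y \<in> derived G (carrier G)"
      unfolding derived_def using xy by (intro generate.incl) auto
    moreover have "x \<otimes> y = (x \<otimes> y \<otimes> inv x \<otimes> inv y) \<otimes> (y \<otimes> x)"
    proof -
      have "inv y \<otimes> (y \<otimes> x) = x" "inv x \<otimes> x = \<one>"
        using xy by (simp_all flip: m_assoc)
      then show ?thesis using xy by (simp add: m_assoc)
    qed
    ultimately have "x \<otimes> y \<in> derived G (carrier G) #> (y \<otimes> x)" 
      unfolding r_coset_def by blast
    then have "derived G (carrier G) #> (x \<otimes> y) = derived G (carrier G) #> (y \<otimes> x)"
      using xy by (intro repr_independence[symmetric]) (auto intro: D.subgroup_axioms)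
    then show "U \<otimes>\<^bsub>G Mod derived G (carrier G)\<^esub> V = V \<otimes>\<^bsub>G Mod derived G (carrier G)\<^esub> U"
      using xy by (simp add: D.rcos_sum)
  qed
qed

text \<open>In an abelian group the elements annihilated by \<open>n\<close> form a subgroup, so it suffices to look at
  the images of the generators in the abelianization.\<close>
lemma (in group) pow_in_derived:
  assumes X: "X \<subseteq> carrier G" "generate G X = carrier G" "\<And>x. x \<in> X \<Longrightarrow> x [^] n = \<one>"
    and s: "s \<in> carrier G"
  shows "s [^] (n::nat) \<in> derived G (carrier G)"
proof -
  let ?D = "derived G (carrier G)"
  interpret D: normal ?D G by (rule derived_self_is_normal)
  interpret Q: comm_group "G Mod ?D" by (rule comm_group_abelianization)
  interpret q: group_hom G "G Mod ?D" "\<lambda>x. ?D #> x"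
    by unfold_locales (rule D.r_coset_hom_Mod)
  have h: "group_hom G (G Mod ?D) (\<lambda>x. (?D #> x) [^]\<^bsub>G Mod ?D\<^esub> n)"
    using q.hom_closed
    by (intro group_hom.intro group_hom_axioms.intro is_group Q.is_group homI)
       (auto simp: Q.nat_pow_distrib simp del: mult_FactGroup)
  have "generate G X \<subseteq> kernel G (G Mod ?D) (\<lambda>x. (?D #> x) [^]\<^bsub>G Mod ?D\<^esub> n)"
  proof (rule generate_subgroup_incl)
    show "X \<subseteq> kernel G (G Mod ?D) (\<lambda>x. (?D #> x) [^]\<^bsub>G Mod ?D\<^esub> n)"
      using X D.rcos_const[OF is_group, of \<one>]
      by (auto simp: kernel_def D.FactGroup_pow D.one_closed subset_iff)
    show "subgroup (kernel G (G Mod ?D) (\<lambda>x. (?D #> x) [^]\<^bsub>G Mod ?D\<^esub> n)) G"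
      by (rule group_hom.subgroup_kernel[OF h])
  qed
  then have "?D #> (s [^] n) = ?D"
    using s X by (auto simp: kernel_def D.FactGroup_pow subset_iff)
  then show ?thesis
    using s D.subgroup_axioms coset_join1 by blast
qed

section \<open>Central extensions and the Schur multiplier\<close>

text \<open>Lagrange's theorem in the second homology group, expressed by representatives. If that
  group is infinite, its order is \<open>0\<close> and the multiple of \<open>c\<close> is zero.\<close>
lemma schur_multiplier_exponent:
  assumes K: "group K" and c: "c \<in> bar_cycles2 K"
  shows "frag_cmul (int (order (schur_multiplier K))) c \<in> bar_boundaries2 K"
proof -
  let ?C1 = "free_Abelian_group (carrier K)"
  let ?C2 = "free_Abelian_group (carrier K \<times> carrier K)"
  let ?C3 = "free_Abelian_group (carrier K \<times> carrier K \<times> carrier K)"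
  let ?Z = "?C2\<lparr>carrier := bar_cycles2 K\<rparr>"
  interpret d2: group_hom ?C2 ?C1 "bar_d2 K"
    unfolding group_hom_def group_hom_axioms_def hom_def
    using bar_d2_closed[OF K] by (auto simp: bar_d2_def frag_extend_add)
  interpret d3: group_hom ?C3 ?C2 "bar_d3 K"
    unfolding group_hom_def group_hom_axioms_def hom_def
    using bar_d3_closed[OF K] by (auto simp: bar_d3_def frag_extend_add)
  have Z: "subgroup (bar_cycles2 K) ?C2"
    unfolding bar_cycles2_def by (rule d2.subgroup_kernel)
  interpret Z: comm_group ?Z
    by (rule group.group_comm_groupI[OF group.subgroup_imp_group[OF group_free_Abelian_group Z]])
       (simp add: add.commute)
  have "bar_boundaries2 K \<subseteq> bar_cycles2 K"
    unfolding bar_cycles2_def bar_boundaries2_def kernel_def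
    using bar_d3_closed[OF K] bar_d2_d3[OF K] by (simp add: image_subset_iff)
  then have B: "subgroup (bar_boundaries2 K) ?Z"
    unfolding bar_boundaries2_def
    by (intro group.subgroup_incl[OF group_free_Abelian_group d3.img_is_subgroup Z])
  then interpret B: normal "bar_boundaries2 K" ?Z by (rule Z.subgroup_imp_normal)
  interpret Q: group "schur_multiplier K"
    using comm_group_schur_multiplier[OF K] by (simp add: comm_group_def)
  let ?m = "order (schur_multiplier K)"
  have pow: "c [^]\<^bsub>?Z\<^esub> j = frag_cmul (int j) c" for j :: nat
    by (induction j) (simp_all add: frag_cmul_distrib)
  have "bar_boundaries2 K #>\<^bsub>?Z\<^esub> c \<in> carrier (schur_multiplier K)"
    using c by (auto simp: schur_multiplier_def carrier_FactGroup)
  then have "(bar_boundaries2 K #>\<^bsub>?Z\<^esub> c) [^]\<^bsub>schur_multiplier K\<^esub> ?m = \<one>\<^bsub>schur_multiplier K\<^esub>"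
    by (rule Q.pow_order_eq_1)
  then have "bar_boundaries2 K #>\<^bsub>?Z\<^esub> (c [^]\<^bsub>?Z\<^esub> ?m) = bar_boundaries2 K"
    unfolding schur_multiplier_def using c B.FactGroup_pow[of c ?m]
    by (simp add: schur_multiplier_def)
  then have "c [^]\<^bsub>?Z\<^esub> ?m \<in> bar_boundaries2 K"
    by (rule Z.coset_join1[OF _ Z.nat_pow_closed B]) (simp add: c)
  then show ?thesis by (simp only: pow)
qed

locale central_extension = group_hom G H \<phi>
  for G (structure) and H (structure) and \<phi> +
  assumes surj: "\<phi> ` carrier G = carrier H"
    and central: "\<And>k s. k \<in> kernel G H \<phi> \<Longrightarrow> s \<in> carrier G \<Longrightarrow> s \<otimes> k = k \<otimes> s"
begin

abbreviation "K \<equiv> G\<lparr>carrier := kernel G H \<phi>\<rparr>"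

definition "\<sigma> = inv_into (carrier G) \<phi>"

definition "\<kappa> s = s \<otimes> inv \<sigma> (\<phi> s)"

definition "cocycle g h = \<sigma> g \<otimes> \<sigma> h \<otimes> inv \<sigma> (g \<otimes>\<^bsub>H\<^esub> h)"

lemma section_props [simp]:
  assumes "g \<in> carrier H"
  shows "\<sigma> g \<in> carrier G" "\<phi> (\<sigma> g) = g"
  using assms surj by (auto simp: \<sigma>_def inv_into_into f_inv_into_f)

lemma kernel_closed: "k \<in> kernel G H \<phi> \<Longrightarrow> k \<in> carrier G"
  by (simp add: kernel_def)

sublocale K: comm_group K
  by (rule group.group_comm_groupI[OF subgroup.subgroup_is_group[OF subgroup_kernel G.is_group]])
     (auto intro: central kernel_closed)

lemma remainder_in_kernel [simp]: "s \<in> carrier G \<Longrightarrow> \<kappa> s \<in> kernel G H \<phi>"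
  by (simp add: \<kappa>_def kernel_def)

lemma cocycle_in_kernel [simp]:
  "g \<in> carrier H \<Longrightarrow> h \<in> carrier H \<Longrightarrow> cocycle g h \<in> kernel G H \<phi>"
  by (simp add: cocycle_def kernel_def)

lemma remainder_section:
  "s \<in> carrier G \<Longrightarrow> \<kappa> s \<otimes> \<sigma> (\<phi> s) = s"
  by (simp add: \<kappa>_def G.m_assoc)

lemma section_mult:
  "g \<in> carrier H \<Longrightarrow> h \<in> carrier H \<Longrightarrow> \<sigma> g \<otimes> \<sigma> h = cocycle g h \<otimes> \<sigma> (g \<otimes>\<^bsub>H\<^esub> h)"
  by (simp add: cocycle_def G.m_assoc)

text \<open>Choosing the section turns the extension into a product \<open>K \<times> H\<close> of sets, with \<open>s\<close> corresponding to
  \<open>(\<kappa> s, \<phi> s)\<close>. As \<open>K\<close> is central, the cocycle is the only deviation from the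
  componentwise multiplication.\<close>
lemma remainder_mult:
  assumes s: "s \<in> carrier G" and t: "t \<in> carrier G"
  shows "\<kappa> (s \<otimes> t) = \<kappa> s \<otimes> \<kappa> t \<otimes> cocycle (\<phi> s) (\<phi> t)"
proof -
  have c: "\<kappa> s \<in> carrier G" "\<kappa> t \<in> carrier G" "cocycle (\<phi> s) (\<phi> t) \<in> carrier G"
    using s t by (auto intro: kernel_closed)
  have "s \<otimes> t = \<kappa> s \<otimes> \<sigma> (\<phi> s) \<otimes> (\<kappa> t \<otimes> \<sigma> (\<phi> t))"
    using s t by (simp add: remainder_section)
  also have "\<dots> = \<kappa> s \<otimes> (\<sigma> (\<phi> s) \<otimes> \<kappa> t) \<otimes> \<sigma> (\<phi> t)"
    using s t c by (simp add: G.m_assoc)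
  also have "\<dots> = \<kappa> s \<otimes> \<kappa> t \<otimes> (\<sigma> (\<phi> s) \<otimes> \<sigma> (\<phi> t))"
    using s t c by (simp add: G.m_assoc central)
  also have "\<dots> = \<kappa> s \<otimes> \<kappa> t \<otimes> cocycle (\<phi> s) (\<phi> t) \<otimes> \<sigma> (\<phi> (s \<otimes> t))"
    using s t c by (simp add: G.m_assoc section_mult)
  finally have eq: "s \<otimes> t = \<kappa> s \<otimes> \<kappa> t \<otimes> cocycle (\<phi> s) (\<phi> t) \<otimes> \<sigma> (\<phi> (s \<otimes> t))" .
  show ?thesis
    using arg_cong[OF eq, of "\<lambda>x. x \<otimes> inv \<sigma> (\<phi> (s \<otimes> t))"] s t c
    by (simp add: \<kappa>_def[of "s \<otimes> t"] G.m_assoc)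
qed

text \<open>Both sides compare \<open>\<sigma> g \<otimes> \<sigma> h \<otimes> \<sigma> k\<close>, evaluated with the two possible bracketings, to
  \<open>\<sigma> (g \<otimes> h \<otimes> k)\<close>.\<close>
lemma cocycle_identity:
  assumes g: "g \<in> carrier H" and h: "h \<in> carrier H" and k: "k \<in> carrier H"
  shows "cocycle h k \<otimes> cocycle g (h \<otimes>\<^bsub>H\<^esub> k) = cocycle g h \<otimes> cocycle (g \<otimes>\<^bsub>H\<^esub> h) k"
proof -
  note c = cocycle_in_kernel[THEN kernel_closed]
  have "cocycle g h \<otimes> cocycle (g \<otimes>\<^bsub>H\<^esub> h) k \<otimes> \<sigma> (g \<otimes>\<^bsub>H\<^esub> h \<otimes>\<^bsub>H\<^esub> k)
      = cocycle g h \<otimes> (\<sigma> (g \<otimes>\<^bsub>H\<^esub> h) \<otimes> \<sigma> k)"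
    using g h k c by (simp add: G.m_assoc section_mult[of "g \<otimes>\<^bsub>H\<^esub> h" k])
  also have "\<dots> = \<sigma> g \<otimes> \<sigma> h \<otimes> \<sigma> k"
    using g h k c by (simp add: section_mult[of g h] G.m_assoc)
  also have "\<dots> = \<sigma> g \<otimes> cocycle h k \<otimes> \<sigma> (h \<otimes>\<^bsub>H\<^esub> k)"
    using g h k c by (simp add: G.m_assoc section_mult[of h k])
  also have "\<dots> = cocycle h k \<otimes> (\<sigma> g \<otimes> \<sigma> (h \<otimes>\<^bsub>H\<^esub> k))"
    using g h k c by (simp add: central[of "cocycle h k" "\<sigma> g"] G.m_assoc[symmetric])
  also have "\<dots> = cocycle h k \<otimes> cocycle g (h \<otimes>\<^bsub>H\<^esub> k) \<otimes> \<sigma> (g \<otimes>\<^bsub>H\<^esub> h \<otimes>\<^bsub>H\<^esub> k)"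
    using g h k c by (simp add: section_mult G.m_assoc H.m_assoc)
  finally show ?thesis using g h k c by simp
qed

text \<open>The linear extension \<open>\<theta>\<close> of the cocycle to 2-chains vanishes on boundaries. The map
  \<open>H\<^sub>2(H) \<rightarrow> K\<close> that it induces is the one in the five-term exact sequence, independent of
  the section.\<close>

context
  fixes \<theta>
  assumes \<theta>: "\<theta> \<in> hom (free_Abelian_group (carrier H \<times> carrier H)) K"
    and \<theta>_gen: "\<And>g h. g \<in> carrier H \<Longrightarrow> h \<in> carrier H \<Longrightarrow> \<theta> (frag_of (g, h)) = cocycle g h"
begin

interpretation t: group_hom "free_Abelian_group (carrier H \<times> carrier H)" K \<theta>
  by (intro group_hom.intro group_hom_axioms.intro group_free_Abelian_group K.is_group \<theta>)

lemma cocycle_map_add: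
  assumes "Poly_Mapping.keys c \<subseteq> carrier H \<times> carrier H" "Poly_Mapping.keys c' \<subseteq> carrier H \<times> carrier H"
  shows "\<theta> (c + c') = \<theta> c \<otimes> \<theta> c'"
  using t.hom_mult[of c c'] assms by simp

lemma cocycle_map_in_kernel:
  assumes "Poly_Mapping.keys c \<subseteq> carrier H \<times> carrier H"
  shows "\<theta> c \<in> kernel G H \<phi>"
  using t.hom_closed[of c] assms by simp

text \<open>The exactness of the five-term sequence at \<open>K\<close>. Let \<open>M\<close> be the quotient of \<open>K \<times> \<int>[H]\<close> by all pairs
  \<open>(\<theta> c, - d\<^sub>2 c)\<close> with \<open>c\<close> a 2-chain. These relations say exactly that
  \<open>s \<mapsto> (\<kappa> s, \<phi> s)\<close> becomes a homomorphism from \<open>G\<close> to \<open>M\<close>, by \<open>remainder_mult\<close>. As \<open>M\<close> is abelian,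
  commutators vanish in \<open>M\<close>. For an element \<open>k\<close> of \<open>K\<close> this means that \<open>k\<close> is, up to the
  contribution of \<open>\<sigma> \<one>\<close>, some \<open>\<theta> c\<close> with \<open>d\<^sub>2 c = 0\<close>.\<close>
lemma kernel_Int_derived_is_cocycle_map_of_cycle:
  assumes k: "k \<in> kernel G H \<phi>" "k \<in> derived G (carrier G)"
  shows "\<exists>c\<in>bar_cycles2 H. \<theta> c = k"
proof -
  let ?C1 = "free_Abelian_group (carrier H)"
  let ?C2 = "free_Abelian_group (carrier H \<times> carrier H)"
  interpret C1: comm_group ?C1 by (rule abelian_free_Abelian_group)
  have d2: "bar_d2 H \<in> hom ?C2 ?C1"
    using bar_d2_closed[OF H.is_group] by (auto simp: hom_def bar_d2_def frag_extend_add)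
  let ?A = "K \<times>\<times> ?C1"
  interpret A: comm_group ?A
    by (rule comm_group_DirProd[OF K.comm_group_axioms C1.comm_group_axioms])
  define \<rho> where "\<rho> c = (\<theta> c, - bar_d2 H c)" for c
  have "\<rho> \<in> hom ?C2 ?A"
  proof (rule homI)
    fix c c' assume c: "c \<in> carrier ?C2" "c' \<in> carrier ?C2"
    show "\<rho> c \<in> carrier ?A"
      using c t.hom_closed[of c] hom_in_carrier[OF d2, of c] by (simp add: \<rho>_def)
    show "\<rho> (c \<otimes>\<^bsub>?C2\<^esub> c') = \<rho> c \<otimes>\<^bsub>?A\<^esub> \<rho> c'"
      using c by (simp add: \<rho>_def cocycle_map_add hom_frag_add[OF d2])
  qed
  then interpret r: group_hom ?C2 ?A \<rho>
    by (intro group_hom.intro group_hom_axioms.intro group_free_Abelian_group A.is_group)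
  define R where "R = \<rho> ` carrier ?C2"
  have R: "subgroup R ?A"
    unfolding R_def by (rule r.img_is_subgroup)
  then interpret R: normal R ?A
    by (rule A.subgroup_imp_normal)
  interpret Q: comm_group "?A Mod R"
    by (rule A.abelian_FactGroup[OF R])
  define \<alpha> where "\<alpha> s = (\<kappa> s, frag_of (\<phi> s))" for s
  have \<alpha>_closed: "\<alpha> s \<in> carrier ?A" if "s \<in> carrier G" for s
    using that by (simp add: \<alpha>_def)
  have \<alpha>_mult: "\<alpha> (s \<otimes> t) = \<rho> (frag_of (\<phi> s, \<phi> t)) \<otimes>\<^bsub>?A\<^esub> (\<alpha> s \<otimes>\<^bsub>?A\<^esub> \<alpha> t)"
    if st: "s \<in> carrier G" "t \<in> carrier G" for s t
  proof -
    have "\<kappa> (s \<otimes> t) = cocycle (\<phi> s) (\<phi> t) \<otimes> (\<kappa> s \<otimes> \<kappa> t)"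
      using st by (simp add: remainder_mult central[of "cocycle (\<phi> s) (\<phi> t)"] kernel_closed)
    then show ?thesis
      using st by (simp add: \<alpha>_def \<rho>_def \<theta>_gen bar_d2_def)
  qed
  have "(\<lambda>s. R #>\<^bsub>?A\<^esub> \<alpha> s) \<in> hom G (?A Mod R)"
  proof (rule homI)
    fix s t assume st: "s \<in> carrier G" "t \<in> carrier G"
    show "R #>\<^bsub>?A\<^esub> \<alpha> s \<in> carrier (?A Mod R)"
      using st \<alpha>_closed by (auto simp: carrier_FactGroup)
    have \<rho>: "\<rho> (frag_of (\<phi> s, \<phi> t)) \<in> R"
      unfolding R_def using st by (intro imageI) simp
    then have "R #>\<^bsub>?A\<^esub> \<alpha> (s \<otimes> t) = R #>\<^bsub>?A\<^esub> \<rho> (frag_of (\<phi> s, \<phi> t)) #>\<^bsub>?A\<^esub> (\<alpha> s \<otimes>\<^bsub>?A\<^esub> \<alpha> t)"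
      unfolding \<alpha>_mult[OF st] using st \<alpha>_closed R.subset
      by (intro A.coset_mult_assoc[symmetric] A.m_closed) auto
    also have "\<dots> = R #>\<^bsub>?A\<^esub> (\<alpha> s \<otimes>\<^bsub>?A\<^esub> \<alpha> t)"
      by (simp only: R.rcos_const[OF A.is_group \<rho>])
    also have "\<dots> = (R #>\<^bsub>?A\<^esub> \<alpha> s) \<otimes>\<^bsub>?A Mod R\<^esub> (R #>\<^bsub>?A\<^esub> \<alpha> t)"
      using R.rcos_sum[OF \<alpha>_closed \<alpha>_closed] st by (simp only: mult_FactGroup)
    finally show "R #>\<^bsub>?A\<^esub> \<alpha> (s \<otimes> t) = (R #>\<^bsub>?A\<^esub> \<alpha> s) \<otimes>\<^bsub>?A Mod R\<^esub> (R #>\<^bsub>?A\<^esub> \<alpha> t)" .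
  qed
  then interpret Psi: group_hom G "?A Mod R" "\<lambda>s. R #>\<^bsub>?A\<^esub> \<alpha> s"
    by unfold_locales
  have "R #>\<^bsub>?A\<^esub> \<alpha> k = R"
    using Psi.derived_le_kernel[OF Q.comm_group_axioms] k(2) by (auto simp: kernel_def)
  then have "\<alpha> k \<in> R"
    by (rule A.coset_join1[OF _ \<alpha>_closed R]) (rule kernel_closed[OF k(1)])
  then obtain c where c: "Poly_Mapping.keys c \<subseteq> carrier H \<times> carrier H"
    and \<alpha>c: "\<kappa> k = \<theta> c" "frag_of (\<phi> k) = - bar_d2 H c"
    by (auto simp: R_def \<rho>_def \<alpha>_def)
  \<comment> \<open>The section need not send \<open>\<one>\<close> to \<open>\<one>\<close>; the chain \<open>?e\<close>, with value \<open>\<sigma> \<one>\<close> and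
      boundary \<open>\<one>\<close>, corrects this.\<close>
  let ?e = "frag_of (\<one>\<^bsub>H\<^esub>, \<one>\<^bsub>H\<^esub>)"
  have k1: "\<phi> k = \<one>\<^bsub>H\<^esub>" using k by (simp add: kernel_def)
  have e: "Poly_Mapping.keys ?e \<subseteq> carrier H \<times> carrier H" by simp
  have "\<theta> (c + ?e) = \<kappa> k \<otimes> \<sigma> (\<phi> k)"
    using c by (simp add: cocycle_map_add[OF c e] \<theta>_gen \<alpha>c(1) cocycle_def k1 G.m_assoc)
  then have "\<theta> (c + ?e) = k"
    using remainder_section kernel_closed[OF k(1)] by simp
  moreover have "bar_d2 H (c + ?e) = bar_d2 H c + frag_of \<one>\<^bsub>H\<^esub>"
    by (simp add: bar_d2_def frag_extend_add)
  then have "c + ?e \<in> bar_cycles2 H"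
    using c e \<alpha>c(2) k1 Poly_Mapping.keys_add[of c ?e] by (auto simp: bar_cycles2_def kernel_def)
  ultimately show ?thesis by blast
qed

text \<open>The cocycle identity is the vanishing of \<open>\<theta>\<close> on the boundary of a single bar cell.\<close>
lemma cocycle_map_boundary:
  assumes b: "b \<in> bar_boundaries2 H"
  shows "\<theta> b = \<one>"
proof -
  let ?C2 = "free_Abelian_group (carrier H \<times> carrier H)"
  let ?C3 = "free_Abelian_group (carrier H \<times> carrier H \<times> carrier H)"
  have d3: "bar_d3 H \<in> hom ?C3 ?C2"
    using bar_d3_closed[OF H.is_group] by (auto simp: hom_def bar_d3_def frag_extend_add)
  interpret d: group_hom ?C3 K "\<theta> \<circ> bar_d3 H"
    by (intro group_hom.intro group_hom_axioms.intro group_free_Abelian_group K.is_group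
        Group.hom_compose[OF d3 \<theta>])
  have "\<theta> (bar_d3 H a) = \<one>" if "Poly_Mapping.keys a \<subseteq> carrier H \<times> carrier H \<times> carrier H" for a
    using that
  proof (rule free_Abelian_group_induct)
    show "\<theta> (bar_d3 H 0) = \<one>" using d.hom_one by simp
  next
    fix x y assume *: "Poly_Mapping.keys x \<subseteq> carrier H \<times> carrier H \<times> carrier H"
      "Poly_Mapping.keys y \<subseteq> carrier H \<times> carrier H \<times> carrier H"
      "\<theta> (bar_d3 H x) = \<one>" "\<theta> (bar_d3 H y) = \<one>"
    then show "\<theta> (bar_d3 H (x - y)) = \<one>"
      using d.hom_mult[of x "- y"] d.hom_inv[of y] K.inv_one by simp
  next
    fix z assume "z \<in> carrier H \<times> carrier H \<times> carrier H"
    then obtain g h k where z: "z = (g, h, k)" and ghk: "g \<in> carrier H" "h \<in> carrier H" "k \<in> carrier H"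
      by auto
    have zc: "Poly_Mapping.keys (bar_d3 H (frag_of z)) \<subseteq> carrier H \<times> carrier H"
      using bar_d3_closed[OF H.is_group, of "frag_of z"] z ghk by simp
    have "bar_d3 H (frag_of z) + (frag_of (g, h) + frag_of (g \<otimes>\<^bsub>H\<^esub> h, k))
        = frag_of (h, k) + frag_of (g, h \<otimes>\<^bsub>H\<^esub> k)"
      by (simp add: bar_d3_def z)
    then have "\<theta> (bar_d3 H (frag_of z) + (frag_of (g, h) + frag_of (g \<otimes>\<^bsub>H\<^esub> h, k)))
        = cocycle h k \<otimes> cocycle g (h \<otimes>\<^bsub>H\<^esub> k)"
      using ghk by (simp add: cocycle_map_add \<theta>_gen)
    moreover have "Poly_Mapping.keys (frag_of (g, h) + frag_of (g \<otimes>\<^bsub>H\<^esub> h, k)) \<subseteq> carrier H \<times> carrier H"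
      using ghk Poly_Mapping.keys_add[of "frag_of (g, h)" "frag_of (g \<otimes>\<^bsub>H\<^esub> h, k)"] by auto
    ultimately have "\<theta> (bar_d3 H (frag_of z)) \<otimes> (cocycle g h \<otimes> cocycle (g \<otimes>\<^bsub>H\<^esub> h) k)
        = cocycle g h \<otimes> cocycle (g \<otimes>\<^bsub>H\<^esub> h) k"
      using ghk zc by (simp add: cocycle_map_add \<theta>_gen cocycle_identity)
    then show "\<theta> (bar_d3 H (frag_of z)) = \<one>"
      using ghk kernel_closed[OF cocycle_map_in_kernel[OF zc]] by (simp add: kernel_closed)
  qed
  then show ?thesis using b by (auto simp: bar_boundaries2_def)
qed

lemma cocycle_map_cycle_torsion:
  assumes c: "c \<in> bar_cycles2 H"
  shows "\<theta> c [^] order (schur_multiplier H) = \<one>"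
proof -
  have "c \<in> carrier (free_Abelian_group (carrier H \<times> carrier H))"
    using c by (simp add: bar_cycles2_def kernel_def)
  from t.hom_nat_pow[OF this]
  have "\<theta> c [^]\<^bsub>K\<^esub> order (schur_multiplier H) = \<theta> (frag_cmul (int (order (schur_multiplier H))) c)"
    by simp
  then show ?thesis
    using cocycle_map_boundary[OF schur_multiplier_exponent[OF H.is_group c]] by (simp add: nat_pow_def)
qed

end

text \<open>Such an element is \<open>\<theta> c\<close> for a cycle \<open>c\<close>, and \<open>\<theta>\<close> factors through the homology class of \<open>c\<close>.\<close>
lemma kernel_Int_derived_torsion:
  assumes "k \<in> kernel G H \<phi>" "k \<in> derived G (carrier G)"
  shows "k [^] order (schur_multiplier H) = \<one>"
proof -
  have "case_prod cocycle ` (carrier H \<times> carrier H) \<subseteq> carrier K"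
    by auto
  then obtain \<theta> where \<theta>: "\<theta> \<in> hom (free_Abelian_group (carrier H \<times> carrier H)) K"
    and "\<And>x. x \<in> carrier H \<times> carrier H \<Longrightarrow> \<theta> (frag_of x) = case_prod cocycle x"
    by (rule K.free_Abelian_group_universal) blast
  then have gen: "\<And>g h. g \<in> carrier H \<Longrightarrow> h \<in> carrier H \<Longrightarrow> \<theta> (frag_of (g, h)) = cocycle g h"
    by auto
  obtain c where "c \<in> bar_cycles2 H" "\<theta> c = k"
    using kernel_Int_derived_is_cocycle_map_of_cycle[OF \<theta> gen assms] by blast
  then show ?thesis
    using cocycle_map_cycle_torsion[OF \<theta> gen, of c] by blast
qed

end

section \<open>Torsion\<close>

text \<open>The homomorphism \<open>i \<mapsto> k\<^sup>i\<close> on the cyclic group has the same composite with \<open>\<phi>\<close> as the trivial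
  homomorphism, so both agree at the generator \<open>1\<close>.\<close>
lemma cyclic_injection_kernel:
  assumes "group_hom S G \<phi>" and n: "n > 0"
    and inj: "injection_wrt (integer_mod_group n) S \<phi>"
    and k: "k \<in> kernel S G \<phi>" "k [^]\<^bsub>S\<^esub> n = \<one>\<^bsub>S\<^esub>"
  shows "k = \<one>\<^bsub>S\<^esub>"
proof (cases "n = 1")
  case True
  \<comment> \<open>In the trivial cyclic group \<open>1\<close> is outside of the carrier \<open>{0}\<close>.\<close>
  then show ?thesis using k by (simp add: kernel_def group_hom.axioms(1)[OF assms(1), THEN group.is_monoid])
next
  case False
  interpret group_hom S G \<phi> by (rule assms)
  let ?C = "integer_mod_group n"
  have kS: "k \<in> carrier S" and \<phi>k: "\<phi> k = \<one>\<^bsub>G\<^esub>" using k by (auto simp: kernel_def)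
  define t u where "t = restrict (\<lambda>i::int. k [^]\<^bsub>S\<^esub> i) (carrier ?C)"
    and "u = restrict (\<lambda>i::int. \<one>\<^bsub>S\<^esub>) (carrier ?C)"
  have period: "k [^]\<^bsub>S\<^esub> (i mod int n) = k [^]\<^bsub>S\<^esub> i" for i :: int
  proof -
    have "k [^]\<^bsub>S\<^esub> i = k [^]\<^bsub>S\<^esub> (int n * (i div int n) + i mod int n)" by simp
    also have "\<dots> = (k [^]\<^bsub>S\<^esub> int n) [^]\<^bsub>S\<^esub> (i div int n) \<otimes>\<^bsub>S\<^esub> k [^]\<^bsub>S\<^esub> (i mod int n)"
      using kS by (simp only: G.int_pow_mult G.int_pow_pow)
    also have "\<dots> = k [^]\<^bsub>S\<^esub> (i mod int n)"
      using kS k(2) by (simp add: int_pow_int)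
    finally show ?thesis by simp
  qed
  have "t \<in> Hom_set ?C S"
    using kS n by (auto simp: Hom_set_def hom_def t_def period carrier_integer_mod_group G.int_pow_mult)
  moreover have "u \<in> Hom_set ?C S"
    using n by (auto simp: Hom_set_def hom_def u_def carrier_integer_mod_group)
  moreover have "Hom_map ?C \<phi> t = Hom_map ?C \<phi> u"
    using kS \<phi>k by (auto simp: Hom_map_def compose_def t_def u_def hom_int_pow intro!: restrict_ext)
  ultimately have "t = u"
    using inj by (auto simp: injection_wrt_def dest: inj_onD)
  then have "t 1 = u 1" by simp
  then show ?thesis using False kS by (simp add: t_def u_def)
qed

text \<open>The prime factors of the exponent \<open>m\<close> are cancelled one at a time.\<close>
lemma (in group) eq_one_if_pow_eq_one:
  assumes x: "x \<in> carrier G" and "x [^] m = \<one>" and "m > 0"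
    and primes: "\<And>p j. prime p \<Longrightarrow> p dvd m \<Longrightarrow> (x [^] (j::nat)) [^] (p::nat) = \<one> \<Longrightarrow> x [^] j = \<one>"
  shows "x = \<one>"
  using assms(2,3) primes
proof (induction m rule: less_induct)
  case (less m)
  show ?case
  proof (cases "m = 1")
    case False
    then obtain p where p: "prime p" "p dvd m" using prime_factor_nat by blast
    then obtain j where j: "m = j * p" by (metis dvdE mult.commute)
    have "x [^] j = \<one>"
      using less.prems(1) p j x by (intro less.prems(3)[of p]) (simp_all add: nat_pow_pow)
    have j_less: "0 < j" "j < m" using less.prems(2) j prime_gt_1_nat[OF p(1)] by auto
    show ?thesis
    proof (rule less.IH[OF j_less(2) \<open>x [^] j = \<one>\<close> j_less(1)])
      fix q i :: nat
      assume "prime q" "q dvd j" "(x [^] i) [^] q = \<one>"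
      then show "x [^] i = \<one>" by (intro less.prems(3)[of q i]) (simp_all add: j)
    qed
  next
    case True
    then show ?thesis using less.prems(1) x by simp
  qed
qed

text \<open>For \<open>m\<close> the order of a group, this excludes infinite groups: their order is \<open>0\<close>, which every prime
  divides.\<close>
lemma pos_if_prime_divisors_subset:
  assumes "prime_divisors m \<subseteq> prime_divisors n" "n > 0"
  shows "m > 0"
proof (rule ccontr)
  assume "\<not> m > 0"
  then have "{p. prime p} \<subseteq> {p. p dvd n}"
    using assms(1) by (auto simp: prime_divisors_def)
  then show False
    using finite_divisors_nat[OF assms(2)] primes_infinite finite_subset by blast
qed

section \<open>Centrality of the kernel of the active sum\<close>

context active_family
begin

interpretation P: group P by (rule fp.group_free_product)
interpretation N: normal N P by (rule normal_N)
interpretation S: group "active_sum G \<F>" by (rule group_active_sum)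
interpretation \<phi>: group_hom "active_sum G \<F>" G "active_sum_map G"
  by (intro group_hom.intro group_hom_axioms.intro group_active_sum is_group active_sum_map_hom)

abbreviation "S \<equiv> active_sum G \<F>"

definition gen where "gen F x = N #>\<^bsub>P\<^esub> active_incl G \<F> F x"

lemma quotient_hom: "(\<lambda>U. N #>\<^bsub>P\<^esub> U) \<in> hom P S"
  unfolding active_sum_def by (rule N.r_coset_hom_Mod)

interpretation q: group_hom P S "\<lambda>U. N #>\<^bsub>P\<^esub> U"
  by (intro group_hom.intro group_hom_axioms.intro P.is_group group_active_sum quotient_hom)

lemma family_mem_carrier: "F \<in> \<F> \<Longrightarrow> x \<in> F \<Longrightarrow> x \<in> carrier G"
  using subgroup.mem_carrier[OF subgroups] .

lemma gen_hom: "F \<in> \<F> \<Longrightarrow> gen F \<in> hom (G\<lparr>carrier := F\<rparr>) S"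
  using Group.hom_compose[OF fp.fp_incl_hom[of F] quotient_hom]
  by (simp add: gen_def[abs_def] o_def)

lemma gen_closed: "F \<in> \<F> \<Longrightarrow> x \<in> F \<Longrightarrow> gen F x \<in> carrier S"
  using hom_in_carrier[OF gen_hom] by simp

lemma map_gen: "F \<in> \<F> \<Longrightarrow> x \<in> F \<Longrightarrow> active_sum_map G (gen F x) = x"
  unfolding gen_def by (rule active_sum_map_incl)

text \<open>The inverse of a generator lies in the same factor, so every element of the active sum is a product
  of generators.\<close>
lemma gen_induct [consumes 1, case_names one mult]:
  assumes "s \<in> carrier S"
    and one: "Q \<one>\<^bsub>S\<^esub>"
    and mult: "\<And>F x s. F \<in> \<F> \<Longrightarrow> x \<in> F \<Longrightarrow> s \<in> carrier S \<Longrightarrow> Q s \<Longrightarrow> Q (gen F x \<otimes>\<^bsub>S\<^esub> s)"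
  shows "Q s"
proof -
  let ?cls = "fp_class \<F> (\<lambda>F. G\<lparr>carrier := F\<rparr>)"
  have "Q (N #>\<^bsub>P\<^esub> ?cls w)" if "w \<in> fp_words \<F> (\<lambda>F. G\<lparr>carrier := F\<rparr>)" for w
    using that
  proof (induction w)
    case Nil
    then show ?case using one q.hom_one by (simp add: fp.one_free_product)
  next
    case (Cons p w)
    obtain F x where p: "p = (F, x)" by (cases p)
    have cls: "?cls w \<in> carrier P" using Cons.prems p by (auto simp: fp.carrier_free_product)
    have "?cls (p # w) = active_incl G \<F> F x \<otimes>\<^bsub>P\<^esub> ?cls w"
      using Cons p by (simp add: fp_incl_def fp.free_product_mult)
    then have "N #>\<^bsub>P\<^esub> ?cls (p # w) = gen F x \<otimes>\<^bsub>S\<^esub> (N #>\<^bsub>P\<^esub> ?cls w)"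
      unfolding gen_def using Cons p cls active_incl_closed by simp
    then show ?case
      using Cons p mult[of F x] q.hom_closed[OF cls] by simp
  qed
  then show ?thesis using assms(1)
    by (auto simp: active_sum_def carrier_FactGroup fp.carrier_free_product)
qed

lemma generate_gen: "generate S {gen F x | F x. F \<in> \<F> \<and> x \<in> F} = carrier S" (is "generate S ?X = _")
proof
  show "generate S ?X \<subseteq> carrier S"
    by (rule S.generate_incl) (auto intro: gen_closed)
  show "carrier S \<subseteq> generate S ?X"
  proof
    fix s assume "s \<in> carrier S"
    then show "s \<in> generate S ?X"
      by (induction rule: gen_induct) (blast intro: generate.intros)+
  qed
qed

lemma conj_elt_mult:
  assumes "group H" "g \<in> carrier H" "h \<in> carrier H" "k \<in> carrier H"
  shows "conj_elt H g (h \<otimes>\<^bsub>H\<^esub> k) = conj_elt H (conj_elt H g h) k"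
proof -
  interpret H: group H by (rule assms)
  show ?thesis using assms by (simp add: conj_elt_def H.inv_mult_group H.m_assoc)
qed

lemma conj_gen_gen:
  assumes "F1 \<in> \<F>" "F2 \<in> \<F>" "h \<in> F1" "g \<in> F2"
  shows "conj_elt S (gen F2 g) (gen F1 h) = gen (conj_subset G F2 h) (conj_elt G g h)"
proof -
  let ?\<iota> = "active_incl G \<F>"
  let ?r = "inv\<^bsub>P\<^esub> (?\<iota> F1 h) \<otimes>\<^bsub>P\<^esub> ?\<iota> F2 g \<otimes>\<^bsub>P\<^esub> ?\<iota> F1 h
      \<otimes>\<^bsub>P\<^esub> inv\<^bsub>P\<^esub> (?\<iota> (conj_subset G F2 h) (conj_elt G g h))"
  have F: "conj_subset G F2 h \<in> \<F>" "conj_elt G g h \<in> conj_subset G F2 h"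
    using assms conj_closed[of F2 h] subgroup.mem_carrier[OF subgroups] by (auto simp: conj_subset_def)
  have c: "?\<iota> F1 h \<in> carrier P" "?\<iota> F2 g \<in> carrier P"
    "?\<iota> (conj_subset G F2 h) (conj_elt G g h) \<in> carrier P"
    using assms F by (auto intro: active_incl_closed)
  have "?r \<in> active_relators G \<F>"
    unfolding active_relators_def Let_def using assms by blast
  then have "?r \<in> N"
    using P.normal_closure_incl active_relators_kernel by (auto simp: kernel_def)
  then have "N #>\<^bsub>P\<^esub> ?r = \<one>\<^bsub>S\<^esub>"
    by (simp only: N.rcos_const[OF P.is_group] active_sum_def one_FactGroup)
  then have "conj_elt S (gen F2 g) (gen F1 h) \<otimes>\<^bsub>S\<^esub> inv\<^bsub>S\<^esub> gen (conj_subset G F2 h) (conj_elt G g h) = \<one>\<^bsub>S\<^esub>"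
    using c by (simp add: conj_elt_def gen_def)
  then show ?thesis
    using assms F by (simp add: gen_closed conj_elt_def S.inv_solve_right')
qed

text \<open>Iterating the defining relators of the active sum along a word for \<open>s\<close>. The right-hand side only
  depends on the image of \<open>s\<close> in \<open>G\<close>; this is what makes the kernel central.\<close>
lemma conj_gen:
  assumes "s \<in> carrier S" "F \<in> \<F>" "x \<in> F"
  shows "conj_elt S (gen F x) s
    = gen (conj_subset G F (active_sum_map G s)) (conj_elt G x (active_sum_map G s))"
  using assms
proof (induction arbitrary: F x rule: gen_induct)
  case one
  have "x \<in> carrier G" "F \<subseteq> carrier G"
    using one subgroup.subset[OF subgroups] by auto
  then have "conj_elt G x \<one> = x" "conj_subset G F \<one> = F"
    by (auto simp: conj_elt_def conj_subset_def subset_iff image_iff)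
  then show ?case
    using one gen_closed[of F x] by (simp add: conj_elt_def)
next
  case (mult F1 h s)
  have F: "F \<subseteq> carrier G" "h \<in> carrier G" "x \<in> carrier G"
    using mult family_mem_carrier by auto
  have F': "conj_subset G F h \<in> \<F>" "conj_elt G x h \<in> conj_subset G F h"
    using mult conj_closed[of F h] F by (auto simp: conj_subset_def)
  have "conj_elt S (gen F x) (gen F1 h \<otimes>\<^bsub>S\<^esub> s) = conj_elt S (gen (conj_subset G F h) (conj_elt G x h)) s"
    using mult by (simp add: conj_elt_mult[OF group_active_sum] gen_closed conj_gen_gen)
  also have "\<dots> = gen (conj_subset G (conj_subset G F h) (active_sum_map G s))
      (conj_elt G (conj_elt G x h) (active_sum_map G s))"
    by (rule mult.IH[OF F'])
  also have "conj_elt G (conj_elt G x h) (active_sum_map G s) = conj_elt G x (active_sum_map G (gen F1 h \<otimes>\<^bsub>S\<^esub> s))"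
    using mult F by (simp add: gen_closed map_gen conj_elt_mult[OF is_group])
  also have "conj_subset G (conj_subset G F h) (active_sum_map G s) = conj_subset G F (active_sum_map G (gen F1 h \<otimes>\<^bsub>S\<^esub> s))"
    using mult F unfolding conj_subset_def image_image
    by (intro image_cong refl) (auto simp: gen_closed map_gen conj_elt_mult[OF is_group] subset_iff)
  finally show ?case .
qed

lemma kernel_central:
  assumes k: "k \<in> kernel S G (active_sum_map G)" and s: "s \<in> carrier S"
  shows "s \<otimes>\<^bsub>S\<^esub> k = k \<otimes>\<^bsub>S\<^esub> s"
  using s
proof (induction rule: gen_induct)
  case one
  then show ?case using k by (simp add: kernel_def)
next
  case (mult F x s)
  have kS: "k \<in> carrier S" using k by (simp add: kernel_def)
  have g: "gen F x \<in> carrier S" using mult by (simp add: gen_closed)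
  have F: "x \<in> carrier G" "F \<subseteq> carrier G"
    using mult family_mem_carrier by auto
  then have "conj_elt G x \<one> = x" "conj_subset G F \<one> = F"
    by (auto simp: conj_elt_def conj_subset_def subset_iff image_iff)
  then have "inv\<^bsub>S\<^esub> k \<otimes>\<^bsub>S\<^esub> gen F x \<otimes>\<^bsub>S\<^esub> k = gen F x"
    using conj_gen[OF kS, of F x] mult k by (simp add: kernel_def conj_elt_def)
  then have gk: "gen F x \<otimes>\<^bsub>S\<^esub> k = k \<otimes>\<^bsub>S\<^esub> gen F x"
    using kS g by (metis S.inv_solve_left S.m_assoc S.m_closed S.inv_closed)
  have "gen F x \<otimes>\<^bsub>S\<^esub> s \<otimes>\<^bsub>S\<^esub> k = gen F x \<otimes>\<^bsub>S\<^esub> k \<otimes>\<^bsub>S\<^esub> s"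
    using mult kS g by (simp add: S.m_assoc)
  then show ?case using mult kS g by (simp add: gk S.m_assoc)
qed

lemma central_extension_active_sum:
  assumes "generate G (\<Union>\<F>) = carrier G"
  shows "central_extension S G (active_sum_map G)"
  using active_sum_map_surj[OF assms] kernel_central
  by (intro central_extension.intro central_extension_axioms.intro \<phi>.group_hom_axioms)

lemma gen_pow:
  assumes "F \<in> \<F>" "x \<in> F" "group_exponent (G\<lparr>carrier := F\<rparr>) dvd n"
  shows "gen F x [^]\<^bsub>S\<^esub> (n::nat) = \<one>\<^bsub>S\<^esub>"
proof -
  interpret F: group "G\<lparr>carrier := F\<rparr>" using assms subgroups subgroup_imp_group by blast
  interpret g: group_hom "G\<lparr>carrier := F\<rparr>" S "gen F"
    by (intro group_hom.intro group_hom_axioms.intro F.is_group group_active_sum gen_hom assms)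
  have "F.ord x dvd n"
    using assms(2,3) dvd_trans[of "F.ord x" "group_exponent (G\<lparr>carrier := F\<rparr>)" n]
    by (simp add: group_exponent_def dvd_Lcm)
  then have "x [^]\<^bsub>G\<lparr>carrier := F\<rparr>\<^esub> n = \<one>\<^bsub>G\<lparr>carrier := F\<rparr>\<^esub>"
    using assms(2) F.pow_eq_id[of x n] by simp
  then show ?thesis
    using g.hom_nat_pow[of x n] g.hom_one assms(2) by simp
qed

end

section \<open>Active sums and cyclic injections\<close>

theorem corollary7:
  fixes G :: "('a, 'b) monoid_scheme"
    and n :: nat
    and \<F> :: "'a set set"
  assumes "group G" and "finite (carrier G)"
    and "n > 0"
    and "\<And>F. F \<in> \<F> \<Longrightarrow> subgroup F G"
    and "generate G (\<Union>\<F>) = carrier G"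
    and "\<And>F g. F \<in> \<F> \<Longrightarrow> g \<in> carrier G \<Longrightarrow> conj_subset G F g \<in> \<F>"
    and "\<And>F. F \<in> \<F> \<Longrightarrow> group_exponent (G\<lparr>carrier := F\<rparr>) dvd n"
    and "\<And>F. F \<in> \<F> \<Longrightarrow> cellular TYPE('u::infinite) (integer_mod_group n) (G\<lparr>carrier := F\<rparr>)"
    and "prime_divisors (order (schur_multiplier G)) \<subseteq> prime_divisors n"
    and "injection_wrt (integer_mod_group n) (active_sum G \<F>) (active_sum_map G)"
  shows "active_sum_map G \<in> iso (active_sum G \<F>) G"
proof -
  interpret active_family G \<F>
    using assms by (intro active_family.intro active_family_axioms.intro) auto
  interpret E: central_extension S G "active_sum_map G"
    by (rule central_extension_active_sum[OF assms(5)])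
  let ?m = "order (schur_multiplier G)"
  have m: "?m > 0"
    by (rule pos_if_prime_divisors_subset[OF assms(9,3)])
  have no_torsion: "k = \<one>\<^bsub>S\<^esub>" if "k \<in> kernel S G (active_sum_map G)" "k [^]\<^bsub>S\<^esub> n = \<one>\<^bsub>S\<^esub>" for k
    by (rule cyclic_injection_kernel[OF E.group_hom_axioms assms(3,10) that])
  have "k = \<one>\<^bsub>S\<^esub>" if k: "k \<in> kernel S G (active_sum_map G)" for k
  proof (rule no_torsion[OF k])
    have kS: "k \<in> carrier S" by (rule E.kernel_closed[OF k])
    have pow: "k [^]\<^bsub>S\<^esub> j \<in> kernel S G (active_sum_map G)" for j :: nat
      using k by (auto simp: kernel_def E.hom_nat_pow)
    have "k [^]\<^bsub>S\<^esub> n \<in> derived S (carrier S)"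
    proof (rule E.G.pow_in_derived[OF _ generate_gen _ kS])
      show "{gen F x |F x. F \<in> \<F> \<and> x \<in> F} \<subseteq> carrier S" by (auto intro: gen_closed)
      show "y [^]\<^bsub>S\<^esub> n = \<one>\<^bsub>S\<^esub>" if "y \<in> {gen F x |F x. F \<in> \<F> \<and> x \<in> F}" for y
        using that gen_pow assms(7) by blast
    qed
    then have km: "(k [^]\<^bsub>S\<^esub> n) [^]\<^bsub>S\<^esub> ?m = \<one>\<^bsub>S\<^esub>"
      by (intro E.kernel_Int_derived_torsion pow)
    \<comment> \<open>A prime factor \<open>p\<close> of \<open>?m\<close> divides \<open>n\<close>, so that \<open>p\<close>-torsion in the kernel is \<open>n\<close>-torsion.\<close>
    show "k [^]\<^bsub>S\<^esub> n = \<one>\<^bsub>S\<^esub>"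
    proof (rule E.G.eq_one_if_pow_eq_one[OF _ km m])
      fix p j :: nat
      assume p: "prime p" "p dvd ?m" and pj: "((k [^]\<^bsub>S\<^esub> n) [^]\<^bsub>S\<^esub> j) [^]\<^bsub>S\<^esub> p = \<one>\<^bsub>S\<^esub>"
      then have "p dvd n" using assms(9) by (auto simp: prime_divisors_def)
      then obtain l where n: "n = p * l" by blast
      let ?y = "k [^]\<^bsub>S\<^esub> (n * j)"
      have y: "(k [^]\<^bsub>S\<^esub> n) [^]\<^bsub>S\<^esub> j = ?y" using kS by (simp add: E.G.nat_pow_pow)
      have "?y [^]\<^bsub>S\<^esub> n = (?y [^]\<^bsub>S\<^esub> p) [^]\<^bsub>S\<^esub> l"
        using kS by (simp add: E.G.nat_pow_pow n mult_ac)
      also have "\<dots> = \<one>\<^bsub>S\<^esub>" using pj y by simp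
      finally show "(k [^]\<^bsub>S\<^esub> n) [^]\<^bsub>S\<^esub> j = \<one>\<^bsub>S\<^esub>"
        unfolding y by (rule no_torsion[OF pow])
    qed (use kS in simp)
  qed
  then have "kernel S G (active_sum_map G) = {\<one>\<^bsub>S\<^esub>}"
    by (auto simp: kernel_def)
  then show ?thesis
    using E.surj active_sum_map_hom iso_kernel_image[OF group_active_sum assms(1)] by blast
qed

end
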